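(* Let $G$ be a group presented by the presentation $\mathcal P=\langle X:\mathcal R\rangle$ and let $L$ be a subgroup of $G$. Then the following are equivalent: (a) $\mathcal P$ is $L$-Cockcroft; (b) the map $\pi_1(\mathrm{Sq}^{\rho}(\mathcal P),1)\otimes_L\mathbb Z\to\bigoplus_{r\in\mathcal R}\mathbb Z(G/L)$, obtained by applying $-\otimes_L\mathbb Z$ to the map $\pi_1(\mathrm{Sq}^{\rho}(\mathcal P),1)\to\bigoplus_{r\in\mathcal R}\mathbb ZG$, is the zero map.
   Context: A group presentation $\mathcal P=\langle X:\mathcal R\rangle$ consists of a set $X$ and a set $\mathcal R\subseteq A^*\times A^*$ of pairs of words, where $A=X\cup X^{-1}$ and $A^*$ is the free monoid on $A$. $F(X)$ is the free group on $X$. The canonical map $\rho:A^*\to F(X)$ is suppressed: for $p,q\in F(X)$ and $(l,r)\in\mathcal R$, $plq$ and $prq$ denote $p(l\rho)q,\ p(r\rho)q\in F(X)$. The group presented is $G=F(X)/N$, where $N$ is the normal closure of $\{(l^{-1}r)\rho:(l,r)\in\mathcal R\}$; $\theta:F(X)\to G$ is the quotient map. Direct sums are indexed by the elements of $\mathcal R$ (the pairs). Reduced Squier complex $\mathrm{Sq}^{\rho}(\mathcal P)$: the 2-complex with vertex set $F(X)$; one edge $(p,l,r,q)$ for each $p,q\in F(X)$ and $(l,r)\in\mathcal R$, starting at $plq$ and ending at $prq$; and, for all $p,q,p',q'\in F(X)$ and $(l,r),(l',r')\in\mathcal R$, a 2-cell making the edge paths $(p,l,r,qp'l'q')\circ(prqp',l',r',q')$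 and $(plqp',l',r',q')\circ(p,l,r,qp'r'q')$ homotopic. $\pi_1(\mathrm{Sq}^{\rho}(\mathcal P),1)$ is the fundamental group at the vertex $1\in F(X)$: homotopy classes of closed edge paths at $1$ (paths may traverse edges backwards). $G$-module structures (right modules): $F(X)$ acts on the left and right of homotopy classes of paths by the actions induced by $u\triangleright(p,l,r,q)=(up,l,r,q)$ and $(p,l,r,q)\triangleleft v=(p,l,r,qv)$ on edges; $\pi_1(\mathrm{Sq}^{\rho}(\mathcal P),1)$ is abelian, and the action $\alpha^q=q^{-1}\triangleright\alpha\triangleleft q$ of $q\in F(X)$ on it is trivial for $q\in N$, so it is a $G$-module. $N^{ab}$ (the relation module) is a $G$-module via conjugation $n\mapsto q^{-1}nq$ by $q\in F(X)$. There is a short exact sequence of $G$-modules $$0\to\pi_1(\mathrm{Sq}^{\rho}(\mathcal P),1)\to\bigoplus_{r\in\mathcal R}\mathbb ZG\to N^{ab}\to0.$$ Writing $e_{(l,r)}$ for the basis element of the free module indexed by $(l,r)\in\mathcal R$, the second map sends $e_{(l,r)}$ to the class of $(l^{-1}r)\rho$. The first map sends the class of a closed path to the sum of the contributions of its edges, where a traversal of the edge $(p,l,r,q)$ contributes $e_{(l,r)}\cdot(q\theta)$ and a backwards traversal contributes $-e_{(l,r)}\cdot(q\theta)$. For a subgroup $L\leq G$, applying $-\otimes_L\mathbb Z$ (with $\mathbb Z$ the trivial $L$-module) gives a sequence of abelian groups $$\pi_1(\mathrm{Sq}^{\rho}(\mathcal P),1)\otimes_L\mathbb Z\to\bigoplus_{r\in\mathcal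 R}\mathbb Z(G/L)\to N^{ab}\otimes_L\mathbb Z\to0,$$ where $G/L$ is the set of left cosets of $L$ in $G$. The presentation $\mathcal P$ is $L$-Cockcroft if the map $\bigoplus_{r\in\mathcal R}\mathbb Z(G/L)\to N^{ab}\otimes_L\mathbb Z$ in this sequence is an isomorphism. *)

theory Defs
  imports
    "HOL-Algebra.Free_Abelian_Groups"
    "HOL-Algebra.Generated_Groups"
    "HOL-Algebra.Left_Coset"
begin

text \<open>
  Value of a function \<open>f\<close> on an equivalence class or coset \<open>C\<close>, computed on representatives.
  It is only meaningful when \<open>f\<close> is constant on \<open>C\<close>.
\<close>

definition on_class :: "('a \<Rightarrow> 'b) \<Rightarrow> 'a set \<Rightarrow> 'b" where
  "on_class f C = the_elem (f ` C)"


section \<open>Free groups and group presentations\<close>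

text \<open>The letter \<open>(x, True)\<close> stands for \<open>x\<close> and \<open>(x, False)\<close> for its formal inverse.\<close>

type_synonym 'x letter = "'x \<times> bool"
type_synonym 'x word = "'x letter list"

definition inv_letter :: "'x letter \<Rightarrow> 'x letter" where
  "inv_letter a = (fst a, \<not> snd a)"

definition inv_word :: "'x word \<Rightarrow> 'x word" where
  "inv_word w = rev (map inv_letter w)"

definition words :: "'x set \<Rightarrow> 'x word set" where
  "words X = lists (X \<times> UNIV)"

definition reduced :: "'x word \<Rightarrow> bool" where
  "reduced w \<longleftrightarrow> successively (\<lambda>a b. b \<noteq> inv_letter a) w"

fun push :: "'x letter \<Rightarrow> 'x word \<Rightarrow> 'x word" where
  "push a [] = [a]"
| "push a (b # w) = (if b = inv_letter a then w else a # b # w)"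

text \<open>
  Elements of the free group are represented by reduced words, so the canonical map
  from words to the free group is free reduction.
\<close>

definition rho :: "'x word \<Rightarrow> 'x word" where
  "rho w = foldr push w []"

definition free_group :: "'x set \<Rightarrow> 'x word monoid" where
  "free_group X =
    \<lparr>carrier = {w \<in> words X. reduced w}, monoid.mult = (\<lambda>u v. rho (u @ v)), one = []\<rparr>"

type_synonym 'x relation = "'x word \<times> 'x word"

definition group_presentation :: "'x set \<Rightarrow> 'x relation set \<Rightarrow> bool" where
  "group_presentation X R \<longleftrightarrow> R \<subseteq> words X \<times> words X"

definition relator :: "'x relation \<Rightarrow> 'x word" where
  "relator s = rho (inv_word (fst s) @ snd s)"

definition normal_closure :: "('a, 'm) monoid_scheme \<Rightarrow> 'a set \<Rightarrow> 'a set" where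
  "normal_closure F S = \<Inter>{K. K \<lhd> F \<and> S \<subseteq> K}"

definition relator_subgroup :: "'x set \<Rightarrow> 'x relation set \<Rightarrow> 'x word set" where
  "relator_subgroup X R = normal_closure (free_group X) (relator ` R)"

definition presented_group :: "'x set \<Rightarrow> 'x relation set \<Rightarrow> 'x word set monoid" where
  "presented_group X R = free_group X Mod relator_subgroup X R"

definition theta :: "'x set \<Rightarrow> 'x relation set \<Rightarrow> 'x word \<Rightarrow> 'x word set" where
  "theta X R q = relator_subgroup X R #>\<^bsub>free_group X\<^esub> q"

lemma inv_letter_inv_letter [simp]: "inv_letter (inv_letter a) = a"
  by (simp add: inv_letter_def)

lemma reduced_push: "reduced w \<Longrightarrow> reduced (push a w)"
  by (cases w) (auto simp: reduced_def successively_Cons)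

lemma push_push_inv: "reduced w \<Longrightarrow> push a (push (inv_letter a) w) = w"
proof (cases w)
  case (Cons b v)
  then show "reduced w \<Longrightarrow> push a (push (inv_letter a) w) = w"
    by (cases v) (auto simp: reduced_def)
qed simp

lemma reduced_rho [simp]: "reduced (rho w)"
  by (induction w) (auto simp: rho_def reduced_push, simp add: reduced_def)

lemma rho_reduced: "reduced w \<Longrightarrow> rho w = w"
proof (induction w)
  case (Cons a w)
  then show ?case by (cases w) (auto simp: rho_def reduced_def)
qed (simp add: rho_def)

lemma words_push: "a \<in> X \<times> UNIV \<Longrightarrow> w \<in> words X \<Longrightarrow> push a w \<in> words X"
  by (cases w) (auto simp: words_def)

lemma words_rho: "w \<in> words X \<Longrightarrow> rho w \<in> words X"
proof (induction w)
  case (Cons a w)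
  then have "a \<in> X \<times> UNIV" "w \<in> words X" by (auto simp: words_def)
  with Cons.IH show ?case by (simp add: rho_def words_push)
qed (simp add: rho_def words_def)

lemma words_inv_word: "w \<in> words X \<Longrightarrow> inv_word w \<in> words X"
  by (auto simp: words_def inv_word_def inv_letter_def in_lists_conv_set)

lemma foldr_push_rho:
  "reduced v \<Longrightarrow> foldr push (rho u) v = foldr push u v"
proof (induction u)
  case Nil
  then show ?case by (simp add: rho_def)
next
  case (Cons a u)
  have "reduced (foldr push w v)" for w
    by (induction w) (simp_all add: Cons.prems reduced_push)
  moreover have "foldr push (push a w) v = push a (foldr push w v)"
    if "\<And>z. reduced (foldr push z v)" for w
    by (cases w) (use that push_push_inv[of _ a] in auto)
  moreover have "rho (a # u) = push a (rho u)" by (simp add: rho_def)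
  ultimately show ?case using Cons by simp
qed

lemma rho_append: "rho (u @ v) = foldr push u (rho v)"
  by (simp add: rho_def)

lemma rho_rho_append1: "rho (rho u @ v) = rho (u @ v)"
  by (simp add: rho_append foldr_push_rho)

lemma rho_rho_append2: "rho (u @ rho v) = rho (u @ v)"
  by (simp add: rho_append rho_reduced)

lemma rho_inv_word: "rho (inv_word w @ w) = []"
proof (induction w)
  case (Cons a w)
  have "rho (inv_word (a # w) @ a # w)
      = foldr push (inv_word w) (push (inv_letter a) (push a (rho w)))"
    by (simp add: inv_word_def rho_def)
  also have "push (inv_letter a) (push a (rho w)) = rho w"
    using push_push_inv[of "rho w" "inv_letter a"] by simp
  finally show ?case using Cons by (simp add: rho_append)
qed (simp add: inv_word_def rho_def)

lemma group_free_group: "group (free_group X)"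
proof (rule groupI)
  fix u v w
  assume uvw: "u \<in> carrier (free_group X)" "v \<in> carrier (free_group X)"
    "w \<in> carrier (free_group X)"
  show "u \<otimes>\<^bsub>free_group X\<^esub> v \<in> carrier (free_group X)"
    using uvw words_rho[of "u @ v" X] by (auto simp: free_group_def words_def)
  show "u \<otimes>\<^bsub>free_group X\<^esub> v \<otimes>\<^bsub>free_group X\<^esub> w
      = u \<otimes>\<^bsub>free_group X\<^esub> (v \<otimes>\<^bsub>free_group X\<^esub> w)"
    by (simp add: free_group_def rho_rho_append1 rho_rho_append2)
  show "\<one>\<^bsub>free_group X\<^esub> \<otimes>\<^bsub>free_group X\<^esub> u = u"
    using uvw by (simp add: free_group_def rho_reduced)
  have "rho (inv_word u) \<in> carrier (free_group X)"
    using uvw by (simp add: free_group_def words_rho words_inv_word)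
  moreover have "rho (inv_word u) \<otimes>\<^bsub>free_group X\<^esub> u = \<one>\<^bsub>free_group X\<^esub>"
    by (simp add: free_group_def rho_rho_append1 rho_inv_word)
  ultimately show "\<exists>y\<in>carrier (free_group X). y \<otimes>\<^bsub>free_group X\<^esub> u = \<one>\<^bsub>free_group X\<^esub>"
    by blast
qed (simp add: free_group_def words_def reduced_def)

lemma normal_relator_subgroup:
  assumes "group_presentation X R"
  shows "relator_subgroup X R \<lhd> free_group X"
proof -
  interpret group "free_group X" by (rule group_free_group)
  have "relator s \<in> carrier (free_group X)" if "s \<in> R" for s
  proof -
    have "fst s \<in> words X" "snd s \<in> words X"
      using that assms by (auto simp: group_presentation_def)
    then have "inv_word (fst s) @ snd s \<in> words X"
      using words_inv_word[of "fst s" X] by (simp add: words_def)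
    then show ?thesis by (simp add: relator_def free_group_def words_rho)
  qed
  then have top: "carrier (free_group X) \<in> {K. K \<lhd> free_group X \<and> relator ` R \<subseteq> K}"
    by (auto intro: normal_invI subgroup_self)
  show ?thesis unfolding relator_subgroup_def normal_closure_def
  proof (rule normal_invI)
    show "subgroup (\<Inter>{K. K \<lhd> free_group X \<and> relator ` R \<subseteq> K}) (free_group X)"
      using top by (intro subgroups_Inter) (auto intro: normal_imp_subgroup)
  next
    fix x h
    assume "x \<in> carrier (free_group X)" "h \<in> \<Inter>{K. K \<lhd> free_group X \<and> relator ` R \<subseteq> K}"
    then show "x \<otimes>\<^bsub>free_group X\<^esub> h \<otimes>\<^bsub>free_group X\<^esub> inv\<^bsub>free_group X\<^esub> x
        \<in> \<Inter>{K. K \<lhd> free_group X \<and> relator ` R \<subseteq> K}"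
      by (auto intro: normal.inv_op_closed2)
  qed
qed

lemma group_presented_group:
  "group_presentation X R \<Longrightarrow> group (presented_group X R)"
  unfolding presented_group_def by (rule normal.factorgroup_is_group[OF normal_relator_subgroup])


section \<open>Two-complexes and their fundamental groups\<close>

text \<open>
  A directed edge \<open>(e, True)\<close> is \<open>e\<close> traversed forwards, \<open>(e, False)\<close> is \<open>e\<close> traversed backwards.
  A 2-cell is given by a pair of paths with common endpoints which it makes homotopic.
\<close>

type_synonym 'e path = "('e \<times> bool) list"

record ('v, 'e) two_complex =
  vertices :: "'v set"
  edges :: "'e set"
  src :: "'e \<Rightarrow> 'v"
  tgt :: "'e \<Rightarrow> 'v"
  cells :: "('e path \<times> 'e path) set"

definition dsrc :: "('v, 'e) two_complex \<Rightarrow> 'e \<times> bool \<Rightarrow> 'v" where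
  "dsrc K d = (if snd d then src K (fst d) else tgt K (fst d))"

definition dtgt :: "('v, 'e) two_complex \<Rightarrow> 'e \<times> bool \<Rightarrow> 'v" where
  "dtgt K d = (if snd d then tgt K (fst d) else src K (fst d))"

definition reverse :: "'e \<times> bool \<Rightarrow> 'e \<times> bool" where
  "reverse d = (fst d, \<not> snd d)"

fun is_path :: "('v, 'e) two_complex \<Rightarrow> 'v \<Rightarrow> 'e path \<Rightarrow> 'v \<Rightarrow> bool" where
  "is_path K u [] v \<longleftrightarrow> u \<in> vertices K \<and> u = v"
| "is_path K u (d # \<gamma>) v \<longleftrightarrow> fst d \<in> edges K \<and> dsrc K d = u \<and> is_path K (dtgt K d) \<gamma> v"

inductive homotopic :: "('v, 'e) two_complex \<Rightarrow> 'v \<Rightarrow> 'v \<Rightarrow> 'e path \<Rightarrow> 'e path \<Rightarrow> bool"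
  for K u v where
  refl: "is_path K u \<gamma> v \<Longrightarrow> homotopic K u v \<gamma> \<gamma>"
| sym: "homotopic K u v \<gamma> \<delta> \<Longrightarrow> homotopic K u v \<delta> \<gamma>"
| trans: "homotopic K u v \<gamma> \<delta> \<Longrightarrow> homotopic K u v \<delta> \<epsilon> \<Longrightarrow> homotopic K u v \<gamma> \<epsilon>"
| cancel: "is_path K u (\<gamma> @ [d, reverse d] @ \<delta>) v \<Longrightarrow> is_path K u (\<gamma> @ \<delta>) v
    \<Longrightarrow> homotopic K u v (\<gamma> @ [d, reverse d] @ \<delta>) (\<gamma> @ \<delta>)"
| cell: "(\<sigma>, \<tau>) \<in> cells K \<Longrightarrow> is_path K u (\<gamma> @ \<sigma> @ \<delta>) v \<Longrightarrow> is_path K u (\<gamma> @ \<tau> @ \<delta>) v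
    \<Longrightarrow> homotopic K u v (\<gamma> @ \<sigma> @ \<delta>) (\<gamma> @ \<tau> @ \<delta>)"

definition homotopy_class :: "('v, 'e) two_complex \<Rightarrow> 'v \<Rightarrow> 'v \<Rightarrow> 'e path \<Rightarrow> 'e path set" where
  "homotopy_class K u v \<gamma> = {\<delta>. homotopic K u v \<gamma> \<delta>}"

definition fundamental_group :: "('v, 'e) two_complex \<Rightarrow> 'v \<Rightarrow> 'e path set monoid" where
  "fundamental_group K v =
    \<lparr>carrier = homotopy_class K v v ` {\<gamma>. is_path K v \<gamma> v},
     monoid.mult = (\<lambda>\<alpha> \<beta>. on_class (\<lambda>(\<gamma>, \<delta>). homotopy_class K v v (\<gamma> @ \<delta>)) (\<alpha> \<times> \<beta>)),
     one = homotopy_class K v v []\<rparr>"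


section \<open>The reduced Squier complex\<close>

text \<open>The tuple \<open>(p, l, r, q)\<close> is an edge from \<open>plq\<close> to \<open>prq\<close>.\<close>

type_synonym 'x squier_edge = "'x word \<times> 'x word \<times> 'x word \<times> 'x word"

definition squier_complex ::
  "'x set \<Rightarrow> 'x relation set \<Rightarrow> ('x word, 'x squier_edge) two_complex" where
  "squier_complex X R = (let F = free_group X in
    \<lparr>vertices = carrier F,
     edges = {(p, l, r, q). p \<in> carrier F \<and> q \<in> carrier F \<and> (l, r) \<in> R},
     src = (\<lambda>(p, l, r, q). p \<otimes>\<^bsub>F\<^esub> rho l \<otimes>\<^bsub>F\<^esub> q),
     tgt = (\<lambda>(p, l, r, q). p \<otimes>\<^bsub>F\<^esub> rho r \<otimes>\<^bsub>F\<^esub> q),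
     cells = {([((p, l, r, q \<otimes>\<^bsub>F\<^esub> p' \<otimes>\<^bsub>F\<^esub> rho l' \<otimes>\<^bsub>F\<^esub> q'), True),
                ((p \<otimes>\<^bsub>F\<^esub> rho r \<otimes>\<^bsub>F\<^esub> q \<otimes>\<^bsub>F\<^esub> p', l', r', q'), True)],
               [((p \<otimes>\<^bsub>F\<^esub> rho l \<otimes>\<^bsub>F\<^esub> q \<otimes>\<^bsub>F\<^esub> p', l', r', q'), True),
                ((p, l, r, q \<otimes>\<^bsub>F\<^esub> p' \<otimes>\<^bsub>F\<^esub> rho r' \<otimes>\<^bsub>F\<^esub> q'), True)])
              | p q p' q' l r l' r'.
                p \<in> carrier F \<and> q \<in> carrier F \<and> p' \<in> carrier F \<and> q' \<in> carrier F
                \<and> (l, r) \<in> R \<and> (l', r') \<in> R}\<rparr>)"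

definition left_act :: "'x set \<Rightarrow> 'x word \<Rightarrow> 'x squier_edge path \<Rightarrow> 'x squier_edge path" where
  "left_act X u = map (\<lambda>((p, l, r, q), b). ((u \<otimes>\<^bsub>free_group X\<^esub> p, l, r, q), b))"

definition right_act :: "'x set \<Rightarrow> 'x squier_edge path \<Rightarrow> 'x word \<Rightarrow> 'x squier_edge path" where
  "right_act X \<gamma> v = map (\<lambda>((p, l, r, q), b). ((p, l, r, q \<otimes>\<^bsub>free_group X\<^esub> v), b)) \<gamma>"


section \<open>Modules and tensor products\<close>

text \<open>
  A right (left) \<open>G\<close>-module is an abelian group, written as a multiplicative monoid record,
  together with a right (left) action of \<open>G\<close> on it.
\<close>

record ('a, 'g) right_module = "'a monoid" +
  ract :: "'a \<Rightarrow> 'g \<Rightarrow> 'a"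

record ('b, 'g) left_module = "'b monoid" +
  lact :: "'g \<Rightarrow> 'b \<Rightarrow> 'b"

definition trivial_int :: "(int, 'g) left_module" where
  "trivial_int = \<lparr>carrier = UNIV, monoid.mult = (+), one = 0, lact = (\<lambda>g n. n)\<rparr>"

text \<open>
  The tensor product over the group ring of \<open>L\<close>: the free abelian group on all pairs \<open>(m, n)\<close>,
  modulo biadditivity and \<open>(m g, n) = (m, g n)\<close> for \<open>g \<in> L\<close>.
\<close>

definition tensor_relations ::
  "'g set \<Rightarrow> ('a, 'g) right_module \<Rightarrow> ('b, 'g) left_module \<Rightarrow> ('a \<times> 'b \<Rightarrow>\<^sub>0 int) set" where
  "tensor_relations L M P =
    {frag_of (m \<otimes>\<^bsub>M\<^esub> m', n) - frag_of (m, n) - frag_of (m', n)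
      | m m' n. m \<in> carrier M \<and> m' \<in> carrier M \<and> n \<in> carrier P} \<union>
    {frag_of (m, n \<otimes>\<^bsub>P\<^esub> n') - frag_of (m, n) - frag_of (m, n')
      | m n n'. m \<in> carrier M \<and> n \<in> carrier P \<and> n' \<in> carrier P} \<union>
    {frag_of (ract M m g, n) - frag_of (m, lact P g n)
      | m n g. m \<in> carrier M \<and> n \<in> carrier P \<and> g \<in> L}"

definition tensor_kernel ::
  "'g set \<Rightarrow> ('a, 'g) right_module \<Rightarrow> ('b, 'g) left_module \<Rightarrow> ('a \<times> 'b \<Rightarrow>\<^sub>0 int) set" where
  "tensor_kernel L M P =
    generate (free_Abelian_group (carrier M \<times> carrier P)) (tensor_relations L M P)"

definition tensor ::
  "'g set \<Rightarrow> ('a, 'g) right_module \<Rightarrow> ('b, 'g) left_module \<Rightarrow> ('a \<times> 'b \<Rightarrow>\<^sub>0 int) set monoid" where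
  "tensor L M P = free_Abelian_group (carrier M \<times> carrier P) Mod tensor_kernel L M P"

text \<open>The map induced on tensor products by \<open>f : M \<rightarrow> M'\<close> and the identity of \<open>P\<close>.\<close>

definition tensor_map ::
  "'g set \<Rightarrow> ('a, 'g) right_module \<Rightarrow> ('c, 'g) right_module \<Rightarrow> ('b, 'g) left_module
    \<Rightarrow> ('a \<Rightarrow> 'c) \<Rightarrow> ('a \<times> 'b \<Rightarrow>\<^sub>0 int) set \<Rightarrow> ('c \<times> 'b \<Rightarrow>\<^sub>0 int) set" where
  "tensor_map L M M' P f =
    on_class (\<lambda>c. tensor_kernel L M' P
      #>\<^bsub>free_Abelian_group (carrier M' \<times> carrier P)\<^esub>
        frag_extend (\<lambda>(m, n). frag_of (f m, n)) c)"


section \<open>The modules of the relation sequence\<close>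

definition pi1_squier :: "'x set \<Rightarrow> 'x relation set \<Rightarrow> 'x squier_edge path set monoid" where
  "pi1_squier X R = fundamental_group (squier_complex X R) \<one>\<^bsub>free_group X\<^esub>"

definition pi1_conj ::
  "'x set \<Rightarrow> 'x relation set \<Rightarrow> 'x squier_edge path set \<Rightarrow> 'x word \<Rightarrow> 'x squier_edge path set" where
  "pi1_conj X R \<alpha> q = (let F = free_group X in
    on_class (\<lambda>\<gamma>. homotopy_class (squier_complex X R) \<one>\<^bsub>F\<^esub> \<one>\<^bsub>F\<^esub>
      (right_act X (left_act X (inv\<^bsub>F\<^esub> q) \<gamma>) q)) \<alpha>)"

definition pi1_module ::
  "'x set \<Rightarrow> 'x relation set \<Rightarrow> ('x squier_edge path set, 'x word set) right_module" where
  "pi1_module X R =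
    \<lparr>carrier = carrier (pi1_squier X R), monoid.mult = monoid.mult (pi1_squier X R),
     one = \<one>\<^bsub>pi1_squier X R\<^esub>, ract = (\<lambda>\<alpha>. on_class (pi1_conj X R \<alpha>))\<rparr>"

text \<open>
  The direct sum of copies of \<open>\<int>S\<close> indexed by \<open>R\<close> is the free abelian group on \<open>R \<times> S\<close>;
  for \<open>S = G\<close> the generator \<open>(s, g)\<close> is \<open>e\<^sub>s \<cdot> g\<close>.
\<close>

definition free_module ::
  "'x set \<Rightarrow> 'x relation set \<Rightarrow> ('x relation \<times> 'x word set \<Rightarrow>\<^sub>0 int, 'x word set) right_module" where
  "free_module X R = (let G = presented_group X R; A = free_Abelian_group (R \<times> carrier G) in
    \<lparr>carrier = carrier A, monoid.mult = monoid.mult A, one = \<one>\<^bsub>A\<^esub>,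
     ract = (\<lambda>c g. frag_extend (\<lambda>(s, h). frag_of (s, h \<otimes>\<^bsub>G\<^esub> g)) c)\<rparr>)"

definition Nab :: "'x set \<Rightarrow> 'x relation set \<Rightarrow> 'x word set monoid" where
  "Nab X R = (let F = free_group X; N = relator_subgroup X R in
    F\<lparr>carrier := N\<rparr> Mod derived F N)"

definition Nab_class :: "'x set \<Rightarrow> 'x relation set \<Rightarrow> 'x word \<Rightarrow> 'x word set" where
  "Nab_class X R n = derived (free_group X) (relator_subgroup X R) #>\<^bsub>free_group X\<^esub> n"

definition Nab_conj :: "'x set \<Rightarrow> 'x relation set \<Rightarrow> 'x word set \<Rightarrow> 'x word \<Rightarrow> 'x word set" where
  "Nab_conj X R a q = (let F = free_group X in
    on_class (\<lambda>n. Nab_class X R (inv\<^bsub>F\<^esub> q \<otimes>\<^bsub>F\<^esub> n \<otimes>\<^bsub>F\<^esub> q)) a)"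

definition relation_module ::
  "'x set \<Rightarrow> 'x relation set \<Rightarrow> ('x word set, 'x word set) right_module" where
  "relation_module X R =
    \<lparr>carrier = carrier (Nab X R), monoid.mult = monoid.mult (Nab X R), one = \<one>\<^bsub>Nab X R\<^esub>,
     ract = (\<lambda>a. on_class (Nab_conj X R a))\<rparr>"


section \<open>The maps of the relation sequence\<close>

definition path_contribution ::
  "'x set \<Rightarrow> 'x relation set \<Rightarrow> 'x squier_edge path \<Rightarrow> ('x relation \<times> 'x word set \<Rightarrow>\<^sub>0 int)" where
  "path_contribution X R \<gamma> =
    (\<Sum>((p, l, r, q), b) \<leftarrow> \<gamma>.
      if b then frag_of ((l, r), theta X R q) else - frag_of ((l, r), theta X R q))"

definition pi1_to_free ::
  "'x set \<Rightarrow> 'x relation set \<Rightarrow> 'x squier_edge path set \<Rightarrow> ('x relation \<times> 'x word set \<Rightarrow>\<^sub>0 int)" where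
  "pi1_to_free X R = on_class (path_contribution X R)"

definition free_to_Nab ::
  "'x set \<Rightarrow> 'x relation set \<Rightarrow> ('x relation \<times> 'x word set \<Rightarrow>\<^sub>0 int) \<Rightarrow> 'x word set" where
  "free_to_Nab X R c = (let M = relation_module X R in
    finprod M (\<lambda>(s, g).
        ract M (Nab_class X R (relator s)) g [^]\<^bsub>M\<^esub> Poly_Mapping.lookup c (s, g))
      (Poly_Mapping.keys c))"


section \<open>Applying the functor of tensoring with the trivial module\<close>

definition coset_sum ::
  "'x set \<Rightarrow> 'x relation set \<Rightarrow> 'x word set set
    \<Rightarrow> ('x relation \<times> 'x word set set \<Rightarrow>\<^sub>0 int) monoid" where
  "coset_sum X R L = free_Abelian_group (R \<times> lcosets\<^bsub>presented_group X R\<^esub> L)"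

text \<open>
  The canonical identification of the tensor product of the free module and \<open>\<int>\<close> with
  \<open>coset_sum\<close>: it sends \<open>(e\<^sub>s \<cdot> g) \<otimes> n\<close> to \<open>n (s, gL)\<close>.
\<close>

definition coset_identification ::
  "'x set \<Rightarrow> 'x relation set \<Rightarrow> 'x word set set
    \<Rightarrow> (('x relation \<times> 'x word set \<Rightarrow>\<^sub>0 int) \<times> int \<Rightarrow>\<^sub>0 int) set
    \<Rightarrow> ('x relation \<times> 'x word set set \<Rightarrow>\<^sub>0 int)" where
  "coset_identification X R L =
    on_class (frag_extend (\<lambda>(c, n).
      frag_cmul n (frag_extend (\<lambda>(s, g). frag_of (s, g <#\<^bsub>presented_group X R\<^esub> L)) c)))"

definition pi1_tensor_map ::
  "'x set \<Rightarrow> 'x relation set \<Rightarrow> 'x word set set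
    \<Rightarrow> ('x squier_edge path set \<times> int \<Rightarrow>\<^sub>0 int) set
    \<Rightarrow> ('x relation \<times> 'x word set set \<Rightarrow>\<^sub>0 int)" where
  "pi1_tensor_map X R L t = coset_identification X R L
    (tensor_map L (pi1_module X R) (free_module X R) trivial_int (pi1_to_free X R) t)"

definition Nab_tensor_map ::
  "'x set \<Rightarrow> 'x relation set \<Rightarrow> 'x word set set
    \<Rightarrow> ('x relation \<times> 'x word set set \<Rightarrow>\<^sub>0 int) \<Rightarrow> ('x word set \<times> int \<Rightarrow>\<^sub>0 int) set" where
  "Nab_tensor_map X R L d =
    tensor_map L (free_module X R) (relation_module X R) trivial_int (free_to_Nab X R)
      (inv_into (carrier (tensor L (free_module X R) trivial_int))
        (coset_identification X R L) d)"

definition Cockcroft :: "'x set \<Rightarrow> 'x relation set \<Rightarrow> 'x word set set \<Rightarrow> bool" where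
  "Cockcroft X R L \<longleftrightarrow>
    Nab_tensor_map X R L \<in> iso (coset_sum X R L) (tensor L (relation_module X R) trivial_int)"

end

theory Submission
  imports Defs
begin

text \<open>
  Everything rests on exactness of the relation sequence in the middle and on the right, read off from
  paths starting at \<open>1\<close>. Such a path ends at some \<open>n \<in> N\<close>, and its contribution maps to the class of \<open>n\<close>
  in \<open>N\<^sup>a\<^sup>b\<close>. Concatenation after left translation multiplies end points and adds contributions, so every
  element of \<open>N\<close> is an end point, every element of the free module is a contribution, and every
  element of \<open>[N, N]\<close> is the end point of a path with contribution \<open>0\<close>. If \<open>c\<close> is the contribution of a path
  from \<open>1\<close> to \<open>n\<close> and maps to \<open>0\<close>, then \<open>n \<in> [N, N]\<close> and the path can be closed up without changing \<open>c\<close>.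

  Hence both conditions say that the projection \<open>\<int>G \<rightarrow> \<int>(G/L)\<close>, summed over the relations, kills the
  kernel of the map to \<open>N\<^sup>a\<^sup>b\<close>: if it does, \<open>a \<otimes> n \<mapsto> n\<close> times the projection of any preimage of \<open>a\<close> is a
  left inverse of the map in (a).
\<close>

text \<open>Closed paths see only the kernel of the map to \<open>N^ab\<close>; letting the end
  point range over \<open>N\<close> keeps its image in view as well. Left translation is harmless
  because the contribution of an edge \<open>(p, l, r, q)\<close> forgets \<open>p\<close>, and the
  same freedom in \<open>p\<close> lets an edge with prescribed contribution start at 1.

  Values on classes are taken through \<open>on_class\<close>, so every map must be shown constant
  on its classes before it can be computed. For the actions of \<open>G\<close> this means that
  \<open>N\<close> acts trivially: on \<open>N^ab\<close> because m^-1 n m n^-1 is a commutator, on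
  the fundamental group because the 2-cells allow any two paths to be interchanged.

  The map in (a) is defined through a chosen preimage under the coset identification. Its value is
  pinned down by a formula on generators, \<open>(s, gL)\<close> going to \<phi>(e_s g) tensor 1,
  which agrees modulo the tensor relations with what any preimage yields.\<close>

lemma on_class_eq:
  assumes "a \<in> C" "\<And>x. x \<in> C \<Longrightarrow> f x = f a"
  shows "on_class f C = f a"
proof -
  have "f ` C = {f a}" using assms by blast
  then show ?thesis by (simp add: on_class_def)
qed

section \<open>Tensoring with the trivial module\<close>

text \<open>Restates the closure rules of \<open>generate\<close> additively. The inclusion of
  \<open>H\<close> in the carrier is what identifies the inverse of the group record with unary
  minus.\<close>

lemma generate_free_Abelian_group_induct [consumes 2, case_names zero base minus plus]:
  assumes "z \<in> generate (free_Abelian_group S) H" "H \<subseteq> carrier (free_Abelian_group S)"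
    and "P 0" "\<And>h. h \<in> H \<Longrightarrow> P h" "\<And>x. P x \<Longrightarrow> P (- x)" "\<And>x y. P x \<Longrightarrow> P y \<Longrightarrow> P (x + y)"
  shows "P z"
  using assms(1)
proof induction
  case one
  then show ?case using \<open>P 0\<close> by simp
next
  case (incl h)
  then show ?case by (rule assms(4))
next
  case (inv h)
  then have "inv\<^bsub>free_Abelian_group S\<^esub> h = - h"
    using assms(2) carrier_free_Abelian_group_iff by (metis inv_free_Abelian_group subsetD)
  then show ?case using assms(5)[OF assms(4)[OF inv]] by simp
next
  case (eng x y)
  then show ?case using assms(6)[of x y] by simp
qed

abbreviation tensor_int_kernel :: "'g set \<Rightarrow> ('a, 'g) right_module \<Rightarrow> ('a \<times> int \<Rightarrow>\<^sub>0 int) set" where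
  "tensor_int_kernel L M \<equiv> tensor_kernel L M trivial_int"

text \<open>The carrier of \<open>trivial_int\<close> is kept as it occurs in \<open>tensor\<close>
  and \<open>tensor_map\<close>. The simplifier would turn it into \<open>UNIV\<close>, and facts
  stated about classes would then no longer match; this explains the many \<open>simp only\<close>
  and \<open>unfolding\<close> steps on classes.\<close>

abbreviation tensor_int_class ::
  "'g set \<Rightarrow> ('a, 'g) right_module \<Rightarrow> ('a \<times> int \<Rightarrow>\<^sub>0 int) \<Rightarrow> ('a \<times> int \<Rightarrow>\<^sub>0 int) set" where
  "tensor_int_class L M x \<equiv> tensor_int_kernel L M
    #>\<^bsub>free_Abelian_group (carrier M \<times> carrier (trivial_int :: (int, 'g) left_module))\<^esub> x"

lemma trivial_int_simps [simp]:
  "carrier trivial_int = UNIV" "m \<otimes>\<^bsub>trivial_int\<^esub> n = m + n" "lact trivial_int g n = n"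
  by (simp_all add: trivial_int_def)

text \<open>These closure properties put every tensor relation into the free Abelian group on the
  pairs, so that the relations generate a subgroup of it.\<close>

locale closed_right_module =
  fixes L :: "'g set" and M :: "('a, 'g) right_module"
  assumes mult_closed: "m \<in> carrier M \<Longrightarrow> m' \<in> carrier M \<Longrightarrow> m \<otimes>\<^bsub>M\<^esub> m' \<in> carrier M"
    and ract_closed: "m \<in> carrier M \<Longrightarrow> g \<in> L \<Longrightarrow> ract M m g \<in> carrier M"
begin

lemma tensor_relations_subset:
  "tensor_relations L M trivial_int \<subseteq> carrier (free_Abelian_group (carrier M \<times> UNIV))"
proof -
  have diff2: "Poly_Mapping.keys (a - b) \<subseteq> S"
    if "Poly_Mapping.keys a \<subseteq> S" "Poly_Mapping.keys b \<subseteq> S" for a b :: "'a \<times> int \<Rightarrow>\<^sub>0 int" and S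
    using that keys_diff[of a b] by blast
  show ?thesis
    unfolding tensor_relations_def
    by (intro Un_least; clarify; unfold carrier_free_Abelian_group_iff;
        intro diff2; simp add: mult_closed ract_closed)
qed

lemma subgroup_kernel:
  "subgroup (tensor_int_kernel L M) (free_Abelian_group (carrier M \<times> UNIV))"
  unfolding tensor_kernel_def
  using group.generate_is_subgroup[OF group_free_Abelian_group tensor_relations_subset] by simp

lemma kernel_induct [consumes 1, case_names zero base minus plus]:
  assumes "z \<in> tensor_int_kernel L M"
    and "P 0" "\<And>h. h \<in> tensor_relations L M trivial_int \<Longrightarrow> P h"
      "\<And>x. P x \<Longrightarrow> P (- x)" "\<And>x y. P x \<Longrightarrow> P y \<Longrightarrow> P (x + y)"
  shows "P z"
  using assms(1) unfolding tensor_kernel_def trivial_int_simps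
  by (rule generate_free_Abelian_group_induct[OF _ tensor_relations_subset]) (fact assms)+

lemma kernel_keys: "z \<in> tensor_int_kernel L M \<Longrightarrow> Poly_Mapping.keys z \<subseteq> carrier M \<times> UNIV"
  by (drule subsetD[OF subgroup.subset[OF subgroup_kernel]]) (simp only: carrier_free_Abelian_group_iff)

lemma kernel_0: "0 \<in> tensor_int_kernel L M"
  using subgroup.one_closed[OF subgroup_kernel] by simp

lemma kernel_add: "x \<in> tensor_int_kernel L M \<Longrightarrow> y \<in> tensor_int_kernel L M
    \<Longrightarrow> x + y \<in> tensor_int_kernel L M"
  using subgroup.m_closed[OF subgroup_kernel] by simp

lemma kernel_minus: "x \<in> tensor_int_kernel L M \<Longrightarrow> - x \<in> tensor_int_kernel L M"
  using subgroup.m_inv_closed[OF subgroup_kernel] by (metis inv_free_Abelian_group kernel_keys)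

lemma kernel_diff: "x \<in> tensor_int_kernel L M \<Longrightarrow> y \<in> tensor_int_kernel L M
    \<Longrightarrow> x - y \<in> tensor_int_kernel L M"
  using kernel_add kernel_minus by fastforce

lemma kernel_relation: "h \<in> tensor_relations L M trivial_int \<Longrightarrow> h \<in> tensor_int_kernel L M"
  unfolding tensor_kernel_def by (rule generate.incl)

lemma kernel_cmul: "x \<in> tensor_int_kernel L M \<Longrightarrow> frag_cmul n x \<in> tensor_int_kernel L M"
proof (induction n rule: int_induct[where k = 0])
  case (step1 i)
  then show ?case by (simp add: frag_cmul_distrib kernel_add)
next
  case (step2 i)
  then show ?case by (simp add: frag_cmul_diff_distrib kernel_diff)
qed (simp add: kernel_0)

lemma in_class_iff: "y \<in> tensor_int_class L M x \<longleftrightarrow> y - x \<in> tensor_int_kernel L M"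
  by (auto simp: r_coset_def intro!: bexI[of _ "y - x"])

lemma class_eq_iff: "tensor_int_class L M x = tensor_int_class L M y \<longleftrightarrow> x - y \<in> tensor_int_kernel L M"
proof
  assume "tensor_int_class L M x = tensor_int_class L M y"
  then show "x - y \<in> tensor_int_kernel L M"
    using in_class_iff[of x x] in_class_iff[of x y] kernel_0 by auto
next
  assume xy: "x - y \<in> tensor_int_kernel L M"
  have "z - x \<in> tensor_int_kernel L M \<longleftrightarrow> z - y \<in> tensor_int_kernel L M" for z
    using kernel_add[OF _ xy, of "z - x"] kernel_diff[OF _ xy, of "z - y"] by auto
  then show "tensor_int_class L M x = tensor_int_class L M y"
    using in_class_iff by blast
qed

lemma carrier_tensor:
  "carrier (tensor L M trivial_int)
    = tensor_int_class L M ` {x. Poly_Mapping.keys x \<subseteq> carrier M \<times> UNIV}"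
  by (auto simp: tensor_def carrier_FactGroup)

lemma mult_tensor:
  "tensor_int_class L M x \<otimes>\<^bsub>tensor L M trivial_int\<^esub> tensor_int_class L M y
    = tensor_int_class L M (x + y)"
proof -
  have "z \<in> tensor_int_class L M x <#>\<^bsub>free_Abelian_group (carrier M \<times> UNIV)\<^esub> tensor_int_class L M y
    \<longleftrightarrow> z - (x + y) \<in> tensor_int_kernel L M" for z
  proof
    assume "z - (x + y) \<in> tensor_int_kernel L M"
    then have "z - y \<in> tensor_int_class L M x" "y \<in> tensor_int_class L M y"
      by (simp_all only: in_class_iff) (simp_all add: algebra_simps kernel_0)
    then show "z \<in> tensor_int_class L M x <#>\<^bsub>free_Abelian_group (carrier M \<times> UNIV)\<^esub> tensor_int_class L M y"
      unfolding set_mult_def by force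
  next
    assume "z \<in> tensor_int_class L M x <#>\<^bsub>free_Abelian_group (carrier M \<times> UNIV)\<^esub> tensor_int_class L M y"
    then obtain u v where uv: "z = u + v" "u \<in> tensor_int_class L M x" "v \<in> tensor_int_class L M y"
      unfolding set_mult_def by auto
    then have "(u - x) + (v - y) \<in> tensor_int_kernel L M"
      by (simp only: in_class_iff kernel_add)
    moreover have "(u - x) + (v - y) = z - (x + y)" using uv by simp
    ultimately show "z - (x + y) \<in> tensor_int_kernel L M" by metis
  qed
  then show ?thesis
    by (auto simp: tensor_def in_class_iff simp del: trivial_int_simps) (auto simp: in_class_iff)
qed

text \<open>Additivity in the integer argument carries the claim from \<open>n\<close> to
  \<open>n + 1\<close> and to \<open>n - 1\<close>. Hence elements m tensor 1 generate the tensor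
  product.\<close>

lemma kernel_frag_of_int:
  assumes m: "m \<in> carrier M"
  shows "frag_of (m, n) - frag_cmul n (frag_of (m, 1)) \<in> tensor_int_kernel L M"
proof -
  have rel: "frag_of (m, k + k') - frag_of (m, k) - frag_of (m, k') \<in> tensor_int_kernel L M" for k k'
    by (rule kernel_relation) (use m in \<open>force simp: tensor_relations_def\<close>)
  show ?thesis
  proof (induction n rule: int_induct[where k = 0])
    case base
    \<comment> \<open>For \<open>k = k' = 0\<close> the additivity relation collapses to
      \<open>- frag_of (m, 0)\<close>.\<close>
    show ?case using kernel_minus[OF rel[of 0 0]] by simp
  next
    case (step1 i)
    show ?case using kernel_add[OF step1(2) rel[of i 1]] by (simp add: frag_cmul_distrib algebra_simps)
  next
    case (step2 i)
    show ?case using kernel_diff[OF step2(2) rel[of "i - 1" 1]]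
      by (simp add: frag_cmul_diff_distrib algebra_simps)
  qed
qed

end

text \<open>An additive map that commutes with the action of \<open>L\<close> sends each of the
  three kinds of tensor relation to a relation of the same kind, so the map on pairs carries one
  kernel into the other.\<close>

lemma tensor_map_class:
  assumes "closed_right_module L M" "closed_right_module L M'"
    and closed: "\<And>m. m \<in> carrier M \<Longrightarrow> f m \<in> carrier M'"
    and mult: "\<And>m m'. m \<in> carrier M \<Longrightarrow> m' \<in> carrier M \<Longrightarrow> f (m \<otimes>\<^bsub>M\<^esub> m') = f m \<otimes>\<^bsub>M'\<^esub> f m'"
    and ract: "\<And>m g. m \<in> carrier M \<Longrightarrow> g \<in> L \<Longrightarrow> f (ract M m g) = ract M' (f m) g"
  shows "tensor_map L M M' trivial_int f (tensor_int_class L M x)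
    = tensor_int_class L M' (frag_extend (\<lambda>(m, n). frag_of (f m, n)) x)"
proof -
  interpret M: closed_right_module L M by fact
  interpret M': closed_right_module L M' by fact
  let ?f = "frag_extend (\<lambda>(m, n :: int). frag_of (f m, n))"
  have "?f z \<in> tensor_int_kernel L M'" if "z \<in> tensor_int_kernel L M" for z
    using that
  proof (induction rule: M.kernel_induct)
    case (base h)
    then consider (add) m m' n where "m \<in> carrier M" "m' \<in> carrier M"
        "h = frag_of (m \<otimes>\<^bsub>M\<^esub> m', n) - frag_of (m, n) - frag_of (m', n)"
      | (add_int) m n n' where "m \<in> carrier M" "h = frag_of (m, n + n') - frag_of (m, n) - frag_of (m, n')"
      | (act) m n g where "m \<in> carrier M" "g \<in> L" "h = frag_of (ract M m g, n) - frag_of (m, n)"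
      unfolding tensor_relations_def trivial_int_simps by blast
    then have "?f h \<in> tensor_relations L M' trivial_int"
    proof cases
      case add
      then have "?f h = frag_of (f m \<otimes>\<^bsub>M'\<^esub> f m', n) - frag_of (f m, n) - frag_of (f m', n)"
        by (simp add: frag_extend_diff mult)
      with add show ?thesis unfolding tensor_relations_def trivial_int_simps using closed by blast
    next
      case add_int
      then have "?f h = frag_of (f m, n + n') - frag_of (f m, n) - frag_of (f m, n')"
        by (simp add: frag_extend_diff)
      with add_int show ?thesis unfolding tensor_relations_def trivial_int_simps using closed by blast
    next
      case act
      then have "?f h = frag_of (ract M' (f m) g, n) - frag_of (f m, n)"
        by (simp add: frag_extend_diff ract)
      with act show ?thesis unfolding tensor_relations_def trivial_int_simps using closed by blast
    qed
    then show ?case by (rule M'.kernel_relation)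
  qed (auto simp: M'.kernel_0 M'.kernel_minus M'.kernel_add frag_extend_minus frag_extend_add)
  then show ?thesis
    unfolding tensor_map_def
    by (intro on_class_eq)
      (simp_all only: M.in_class_iff M'.class_eq_iff flip: frag_extend_diff, simp add: M.kernel_0)
qed

section \<open>The relation module\<close>

lemma hom_free_Abelian_group_eq:
  assumes "group K" "f \<in> hom (free_Abelian_group S) K" "h \<in> hom (free_Abelian_group S) K"
    and "\<And>x. x \<in> S \<Longrightarrow> f (frag_of x) = h (frag_of x)"
    and "Poly_Mapping.keys c \<subseteq> S"
  shows "f c = h c"
proof -
  interpret f: group_hom "free_Abelian_group S" K f
    using assms by (simp add: group_hom_def group_hom_axioms_def)
  interpret h: group_hom "free_Abelian_group S" K h
    using assms by (simp add: group_hom_def group_hom_axioms_def)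
  show ?thesis
    using assms(5)
  proof (rule free_Abelian_group_induct)
    show "f 0 = h 0" using f.hom_one h.hom_one by simp
  next
    fix x y assume "Poly_Mapping.keys x \<subseteq> S" "Poly_Mapping.keys y \<subseteq> S" "f x = h x" "f y = h y"
    then have "f (x + - y) = h (x + - y)"
      using f.hom_mult[of x "- y"] h.hom_mult[of x "- y"] f.hom_inv[of y] h.hom_inv[of y] by simp
    then show "f (x - y) = h (x - y)" by simp
  qed (rule assms)
qed

lemma (in group) mult_inv_cancel:
  assumes "x \<in> carrier G" "y \<in> carrier G"
  shows "x \<otimes> (inv x \<otimes> y) = y" "inv x \<otimes> (x \<otimes> y) = y"
  using assms by (simp_all flip: m_assoc)

text \<open>The index set of the product varies with \<open>c\<close>. Since exponents off the keys
  are 0, all products can be taken over one finite set \<open>U\<close> containing the keys of both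
  summands, where they multiply factor by factor.\<close>

lemma (in comm_group) finprod_lookup_hom:
  fixes f :: "'c \<Rightarrow> 'a"
  assumes f: "\<And>a. a \<in> S \<Longrightarrow> f a \<in> carrier G"
  shows "(\<lambda>c. finprod G (\<lambda>a. f a [^] Poly_Mapping.lookup c a) (Poly_Mapping.keys c))
    \<in> hom (free_Abelian_group S) G" (is "?h \<in> _")
proof (rule homI)
  fix c assume "c \<in> carrier (free_Abelian_group S)"
  then have "Poly_Mapping.keys c \<subseteq> S" by simp
  then show "?h c \<in> carrier G"
    by (intro finprod_closed) (use f in blast)
next
  fix c d assume "c \<in> carrier (free_Abelian_group S)" "d \<in> carrier (free_Abelian_group S)"
  then have cd: "Poly_Mapping.keys c \<subseteq> S" "Poly_Mapping.keys d \<subseteq> S" by simp_all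
  define U where "U = Poly_Mapping.keys c \<union> Poly_Mapping.keys d"
  have U: "U \<subseteq> S" "finite U" using cd by (auto simp: U_def)
  have eq: "?h x = finprod G (\<lambda>a. f a [^] Poly_Mapping.lookup x a) U" if "Poly_Mapping.keys x \<subseteq> U" for x
    using that U f by (intro finprod_mono_neutral_cong_left) (auto simp: in_keys_iff subset_iff)
  have "?h (c + d) = finprod G (\<lambda>a. f a [^] Poly_Mapping.lookup (c + d) a) U"
    by (rule eq) (use keys_add[of c d] in \<open>simp add: U_def\<close>)
  also have "\<dots> = finprod G (\<lambda>a. f a [^] Poly_Mapping.lookup c a \<otimes> f a [^] Poly_Mapping.lookup d a) U"
    by (intro finprod_cong') (use U f in \<open>auto simp: lookup_add int_pow_mult subset_iff\<close>)
  also have "\<dots> = ?h c \<otimes> ?h d"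
    using U f by (subst finprod_multf) (auto simp: eq[of c] eq[of d] U_def subset_iff)
  finally show "?h (c \<otimes>\<^bsub>free_Abelian_group S\<^esub> d) = ?h c \<otimes> ?h d" by simp
qed

lemma frag_extend_hom:
  assumes "\<And>x. x \<in> S \<Longrightarrow> Poly_Mapping.keys (f x) \<subseteq> T"
  shows "frag_extend f \<in> hom (free_Abelian_group S) (free_Abelian_group T)"
proof (rule homI)
  fix c assume "c \<in> carrier (free_Abelian_group S)"
  then have "Poly_Mapping.keys c \<subseteq> S" by simp
  then show "frag_extend f c \<in> carrier (free_Abelian_group T)"
    using keys_frag_extend[of f c] assms by fastforce
qed (simp add: frag_extend_add)

locale presentation =
  fixes X :: "'x set" and R :: "'x relation set"
  assumes pres: "group_presentation X R"
begin

abbreviation "F \<equiv> free_group X"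
abbreviation "N \<equiv> relator_subgroup X R"
abbreviation "G \<equiv> presented_group X R"
abbreviation "RM \<equiv> relation_module X R"
abbreviation "FM \<equiv> free_module X R"

sublocale F: group F by (rule group_free_group)
sublocale N: normal N F by (rule normal_relator_subgroup[OF pres])
sublocale G: group G by (rule group_presented_group[OF pres])

lemma rho_closed: "(l, r) \<in> R \<Longrightarrow> rho l \<in> carrier F" "(l, r) \<in> R \<Longrightarrow> rho r \<in> carrier F"
  using pres by (auto simp: group_presentation_def free_group_def words_rho)

lemma relator_eq:
  assumes "(l, r) \<in> R"
  shows "relator (l, r) = inv\<^bsub>F\<^esub> rho l \<otimes>\<^bsub>F\<^esub> rho r"
proof -
  have "l \<in> words X" using assms pres by (auto simp: group_presentation_def)
  then have "rho (inv_word l) \<in> carrier F" by (simp add: free_group_def words_rho words_inv_word)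
  moreover have "rho (inv_word l) \<otimes>\<^bsub>F\<^esub> rho l = \<one>\<^bsub>F\<^esub>"
    by (simp add: free_group_def rho_rho_append1 rho_rho_append2 rho_inv_word)
  ultimately have "inv\<^bsub>F\<^esub> rho l = rho (inv_word l)"
    using rho_closed[OF assms] by (metis F.inv_equality)
  then show ?thesis by (simp add: relator_def free_group_def rho_rho_append1 rho_rho_append2)
qed

lemma relator_in_N: "s \<in> R \<Longrightarrow> relator s \<in> N"
  by (auto simp: relator_subgroup_def normal_closure_def)

lemma relator_subgroup_minimal: "K \<lhd> F \<Longrightarrow> relator ` R \<subseteq> K \<Longrightarrow> N \<subseteq> K"
  by (auto simp: relator_subgroup_def normal_closure_def)

section \<open>The quotient map from the free group to the presented group\<close>

abbreviation "\<theta> \<equiv> theta X R"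

lemma theta_mult: "p \<in> carrier F \<Longrightarrow> q \<in> carrier F \<Longrightarrow> \<theta> p \<otimes>\<^bsub>G\<^esub> \<theta> q = \<theta> (p \<otimes>\<^bsub>F\<^esub> q)"
  by (simp add: theta_def presented_group_def N.rcos_sum)

lemma carrier_G: "carrier G = \<theta> ` carrier F"
  by (simp add: presented_group_def carrier_FactGroup theta_def[abs_def])

lemma theta_closed [simp]: "q \<in> carrier F \<Longrightarrow> \<theta> q \<in> carrier G"
  by (simp add: carrier_G)

lemma in_theta_iff: "q \<in> carrier F \<Longrightarrow> q' \<in> \<theta> q \<longleftrightarrow> (\<exists>n\<in>N. q' = n \<otimes>\<^bsub>F\<^esub> q)"
  by (auto simp: theta_def r_coset_def)

lemma theta_mult_N: "n \<in> N \<Longrightarrow> q \<in> carrier F \<Longrightarrow> \<theta> (n \<otimes>\<^bsub>F\<^esub> q) = \<theta> q"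
  unfolding theta_def by (metis F.coset_mult_assoc N.rcos_const N.subset N.mem_carrier F.group_axioms)

text \<open>Both ends of an edge have the same image in \<open>G\<close>. This is what makes
  contributions invariant under the 2-cells.\<close>

lemma theta_relation:
  assumes "(l, r) \<in> R" "p \<in> carrier F" "q \<in> carrier F"
  shows "\<theta> (p \<otimes>\<^bsub>F\<^esub> rho l \<otimes>\<^bsub>F\<^esub> q) = \<theta> (p \<otimes>\<^bsub>F\<^esub> rho r \<otimes>\<^bsub>F\<^esub> q)"
proof -
  note [simp] = rho_closed[OF assms(1)] assms(2,3)
  \<comment> \<open>Conjugating the relator l^-1 r by p l gives the element of \<open>N\<close> that
    carries p l q to p r q by left multiplication.\<close>
  define n where "n = (p \<otimes>\<^bsub>F\<^esub> rho l) \<otimes>\<^bsub>F\<^esub> relator (l, r) \<otimes>\<^bsub>F\<^esub> inv\<^bsub>F\<^esub> (p \<otimes>\<^bsub>F\<^esub> rho l)"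
  have "n \<in> N" unfolding n_def using relator_in_N[OF assms(1)] by (intro N.inv_op_closed2) auto
  moreover have "n \<otimes>\<^bsub>F\<^esub> (p \<otimes>\<^bsub>F\<^esub> rho l \<otimes>\<^bsub>F\<^esub> q) = p \<otimes>\<^bsub>F\<^esub> rho r \<otimes>\<^bsub>F\<^esub> q"
    by (simp add: n_def relator_eq[OF assms(1)] F.m_assoc F.inv_mult_group F.inv_solve_left
        flip: F.m_assoc) (simp add: F.m_assoc)
  ultimately show ?thesis using theta_mult_N[of n "p \<otimes>\<^bsub>F\<^esub> rho l \<otimes>\<^bsub>F\<^esub> q"] by simp
qed

section \<open>The relation module and its conjugation action\<close>

abbreviation "D \<equiv> derived F N"
abbreviation "cls \<equiv> Nab_class X R"

lemma normal_D: "D \<lhd> F"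
  by (rule F.derived_is_normal[OF N.normal_axioms])

sublocale D: normal D F by (rule normal_D)

lemma cls_mult: "a \<in> carrier F \<Longrightarrow> b \<in> carrier F \<Longrightarrow> cls a <#>\<^bsub>F\<^esub> cls b = cls (a \<otimes>\<^bsub>F\<^esub> b)"
  by (simp add: Nab_class_def D.rcos_sum)

lemma in_cls_iff: "q \<in> carrier F \<Longrightarrow> q' \<in> cls q \<longleftrightarrow> (\<exists>n\<in>D. q' = n \<otimes>\<^bsub>F\<^esub> q)"
  by (auto simp: Nab_class_def r_coset_def)

lemma cls_eq_iff:
  assumes "a \<in> carrier F" "b \<in> carrier F"
  shows "cls a = cls b \<longleftrightarrow> a \<otimes>\<^bsub>F\<^esub> inv\<^bsub>F\<^esub> b \<in> D"
proof
  assume "cls a = cls b"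
  then have "a \<in> D #>\<^bsub>F\<^esub> b"
    using F.rcos_self[OF assms(1) D.subgroup_axioms] by (simp add: Nab_class_def)
  then show "a \<otimes>\<^bsub>F\<^esub> inv\<^bsub>F\<^esub> b \<in> D" using D.rcos_module_imp[OF F.group_axioms assms(2)] by simp
next
  assume "a \<otimes>\<^bsub>F\<^esub> inv\<^bsub>F\<^esub> b \<in> D"
  then have "a \<in> D #>\<^bsub>F\<^esub> b" using D.rcos_module_rev[OF F.group_axioms assms(2,1)] by simp
  then show "cls a = cls b"
    unfolding Nab_class_def by (metis F.repr_independence D.subgroup_axioms assms(2))
qed

lemma RM_simps:
  "carrier RM = cls ` N" "a \<otimes>\<^bsub>RM\<^esub> b = a <#>\<^bsub>F\<^esub> b" "\<one>\<^bsub>RM\<^esub> = D"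
  by (simp_all add: relation_module_def Nab_def Let_def carrier_FactGroup Nab_class_def[abs_def])

lemma comm_group_RM: "comm_group RM"
proof -
  have "comm_group (Nab X R)"
    unfolding Nab_def Let_def
    by (rule F.derived_quot_of_subgroup_is_comm_group[OF N.subgroup_axioms])
  then interpret A: comm_group "Nab X R" .
  show ?thesis
  proof (rule comm_groupI)
    fix x assume "x \<in> carrier RM"
    then show "\<exists>y\<in>carrier RM. y \<otimes>\<^bsub>RM\<^esub> x = \<one>\<^bsub>RM\<^esub>"
      using A.l_inv_ex[of x] by (simp add: relation_module_def)
  qed (use A.m_assoc A.m_comm in \<open>auto simp: relation_module_def\<close>)
qed

sublocale RM: comm_group RM by (rule comm_group_RM)

lemma cls_closed [simp]: "n \<in> N \<Longrightarrow> cls n \<in> carrier RM"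
  by (simp add: RM_simps)

lemma RM_mult_cls: "a \<in> N \<Longrightarrow> b \<in> N \<Longrightarrow> cls a \<otimes>\<^bsub>RM\<^esub> cls b = cls (a \<otimes>\<^bsub>F\<^esub> b)"
  by (simp add: RM_simps cls_mult N.mem_carrier)

lemma RM_one: "\<one>\<^bsub>RM\<^esub> = cls \<one>\<^bsub>F\<^esub>"
  by (simp add: RM_simps Nab_class_def D.subset)

lemma cls_eq_one_iff: "n \<in> N \<Longrightarrow> cls n = \<one>\<^bsub>RM\<^esub> \<longleftrightarrow> n \<in> D"
  by (simp add: RM_one cls_eq_iff N.mem_carrier)

lemma conj_N: "n \<in> N \<Longrightarrow> q \<in> carrier F \<Longrightarrow> inv\<^bsub>F\<^esub> q \<otimes>\<^bsub>F\<^esub> n \<otimes>\<^bsub>F\<^esub> q \<in> N"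
  by (rule N.inv_op_closed1)

text \<open>Replacing n by d n with d in \<open>D\<close> changes the conjugate by the factor q^-1 d
  q, which stays in \<open>D\<close> because the derived subgroup of a normal subgroup is normal in
  \<open>F\<close>.\<close>

lemma Nab_conj_cls:
  assumes "n \<in> N" "q \<in> carrier F"
  shows "Nab_conj X R (cls n) q = cls (inv\<^bsub>F\<^esub> q \<otimes>\<^bsub>F\<^esub> n \<otimes>\<^bsub>F\<^esub> q)"
  unfolding Nab_conj_def Let_def
proof (rule on_class_eq)
  note [simp] = N.mem_carrier[OF assms(1)] assms(2)
  show "n \<in> cls n" unfolding Nab_class_def by (rule F.rcos_self[OF _ D.subgroup_axioms]) simp
  fix m assume "m \<in> cls n"
  then obtain d where d: "d \<in> D" "m = d \<otimes>\<^bsub>F\<^esub> n" using in_cls_iff[of n m] by auto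
  have [simp]: "d \<in> carrier F" using d D.mem_carrier by blast
  have "(inv\<^bsub>F\<^esub> q \<otimes>\<^bsub>F\<^esub> m \<otimes>\<^bsub>F\<^esub> q) \<otimes>\<^bsub>F\<^esub> inv\<^bsub>F\<^esub> (inv\<^bsub>F\<^esub> q \<otimes>\<^bsub>F\<^esub> n \<otimes>\<^bsub>F\<^esub> q)
      = inv\<^bsub>F\<^esub> q \<otimes>\<^bsub>F\<^esub> d \<otimes>\<^bsub>F\<^esub> q"
    using d(2) by (simp add: F.inv_mult_group F.m_assoc F.mult_inv_cancel)
  also have "\<dots> \<in> D" using d(1) by (intro D.inv_op_closed1) simp_all
  finally show "cls (inv\<^bsub>F\<^esub> q \<otimes>\<^bsub>F\<^esub> m \<otimes>\<^bsub>F\<^esub> q) = cls (inv\<^bsub>F\<^esub> q \<otimes>\<^bsub>F\<^esub> n \<otimes>\<^bsub>F\<^esub> q)"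
    using d by (subst cls_eq_iff) simp_all
qed

text \<open>The conjugation by q depends only on \<theta> q because \<open>N\<close> acts trivially
  on its abelianisation: m^-1 n m and n differ by a commutator of elements of
  \<open>N\<close>.\<close>

lemma ract_cls:
  assumes "n \<in> N" "q \<in> carrier F"
  shows "ract RM (cls n) (\<theta> q) = cls (inv\<^bsub>F\<^esub> q \<otimes>\<^bsub>F\<^esub> n \<otimes>\<^bsub>F\<^esub> q)"
proof -
  note [simp] = N.mem_carrier[OF assms(1)] assms(2)
  have "on_class (Nab_conj X R (cls n)) (\<theta> q) = Nab_conj X R (cls n) q"
  proof (rule on_class_eq)
    show "q \<in> \<theta> q" unfolding theta_def by (rule F.rcos_self[OF _ N.subgroup_axioms]) simp
    fix q' assume "q' \<in> \<theta> q"
    then obtain m where m: "m \<in> N" "q' = m \<otimes>\<^bsub>F\<^esub> q" using in_theta_iff[of q q'] by auto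
    have [simp]: "m \<in> carrier F" using m N.mem_carrier by blast
    define c where "c = inv\<^bsub>F\<^esub> m \<otimes>\<^bsub>F\<^esub> n \<otimes>\<^bsub>F\<^esub> m"
    have c: "c \<in> N" "c \<in> carrier F" using conj_N[of n m] assms by (simp_all add: c_def)
    \<comment> \<open>The double inverse brings the quotient into the shape a b a^-1 b^-1 of a
      generator of \<open>D\<close>, with a = m^-1 and b = n.\<close>
    have "c \<otimes>\<^bsub>F\<^esub> inv\<^bsub>F\<^esub> n = inv\<^bsub>F\<^esub> m \<otimes>\<^bsub>F\<^esub> n \<otimes>\<^bsub>F\<^esub> inv\<^bsub>F\<^esub> (inv\<^bsub>F\<^esub> m) \<otimes>\<^bsub>F\<^esub> inv\<^bsub>F\<^esub> n"
      by (simp add: c_def)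
    also have "\<dots> \<in> D"
      unfolding derived_def using m(1) assms(1) by (intro generate.incl) blast
    finally have "cls c = cls n" using c by (subst cls_eq_iff) simp_all
    then have "Nab_conj X R (cls n) q = cls (inv\<^bsub>F\<^esub> q \<otimes>\<^bsub>F\<^esub> c \<otimes>\<^bsub>F\<^esub> q)"
      using Nab_conj_cls[of c q] c by simp
    also have "inv\<^bsub>F\<^esub> q \<otimes>\<^bsub>F\<^esub> c \<otimes>\<^bsub>F\<^esub> q = inv\<^bsub>F\<^esub> q' \<otimes>\<^bsub>F\<^esub> n \<otimes>\<^bsub>F\<^esub> q'"
      using m by (simp add: c_def F.m_assoc F.inv_mult_group)
    also have "cls \<dots> = Nab_conj X R (cls n) q'"
      using Nab_conj_cls[of n q'] m assms by simp
    finally show "Nab_conj X R (cls n) q' = Nab_conj X R (cls n) q" by simp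
  qed
  then show ?thesis using Nab_conj_cls[OF assms] by (simp add: relation_module_def)
qed

lemma ract_RM_closed: "a \<in> carrier RM \<Longrightarrow> g \<in> carrier G \<Longrightarrow> ract RM a g \<in> carrier RM"
  by (auto simp: RM_simps carrier_G ract_cls conj_N)

lemma ract_RM_hom:
  assumes "g \<in> carrier G"
  shows "(\<lambda>a. ract RM a g) \<in> hom RM RM"
proof (rule homI)
  fix a b assume "a \<in> carrier RM" "b \<in> carrier RM"
  then obtain m n q where mn: "m \<in> N" "n \<in> N" "a = cls m" "b = cls n" and q: "q \<in> carrier F" "g = \<theta> q"
    using assms by (auto simp: RM_simps carrier_G)
  have [simp]: "m \<in> carrier F" "n \<in> carrier F" using mn N.mem_carrier by auto
  have "inv\<^bsub>F\<^esub> q \<otimes>\<^bsub>F\<^esub> (m \<otimes>\<^bsub>F\<^esub> n) \<otimes>\<^bsub>F\<^esub> q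
      = (inv\<^bsub>F\<^esub> q \<otimes>\<^bsub>F\<^esub> m \<otimes>\<^bsub>F\<^esub> q) \<otimes>\<^bsub>F\<^esub> (inv\<^bsub>F\<^esub> q \<otimes>\<^bsub>F\<^esub> n \<otimes>\<^bsub>F\<^esub> q)"
    using q by (simp add: F.m_assoc F.mult_inv_cancel)
  then show "ract RM (a \<otimes>\<^bsub>RM\<^esub> b) g = ract RM a g \<otimes>\<^bsub>RM\<^esub> ract RM b g"
    using mn q by (simp add: RM_mult_cls ract_cls conj_N)
qed (use assms ract_RM_closed in simp)

lemma ract_RM_mult:
  assumes "a \<in> carrier RM" "g \<in> carrier G" "h \<in> carrier G"
  shows "ract RM (ract RM a g) h = ract RM a (g \<otimes>\<^bsub>G\<^esub> h)"
proof -
  obtain n p q where n: "n \<in> N" "a = cls n" and pq: "p \<in> carrier F" "g = \<theta> p" "q \<in> carrier F" "h = \<theta> q"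
    using assms by (auto simp: RM_simps carrier_G)
  have [simp]: "n \<in> carrier F" using n N.mem_carrier by auto
  show ?thesis
    using n pq by (simp add: ract_cls conj_N theta_mult) (simp add: F.inv_mult_group F.m_assoc)
qed

section \<open>The map onto the relation module\<close>

abbreviation "\<phi> \<equiv> free_to_Nab X R"
abbreviation "A \<equiv> free_Abelian_group (R \<times> carrier G)"

lemma FM_simps [simp]:
  "carrier FM = carrier A" "a \<otimes>\<^bsub>FM\<^esub> b = a + b" "\<one>\<^bsub>FM\<^esub> = 0"
  "ract FM c g = frag_extend (\<lambda>(s, h). frag_of (s, h \<otimes>\<^bsub>G\<^esub> g)) c"
  by (simp_all add: free_module_def Let_def)

lemma phi_hom: "\<phi> \<in> hom A RM"
proof -
  let ?f = "\<lambda>(s, g). ract RM (cls (relator s)) g"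
  have "?f a \<in> carrier RM" if "a \<in> R \<times> carrier G" for a
    using that by (auto intro!: ract_RM_closed cls_closed relator_in_N)
  from RM.finprod_lookup_hom[of "R \<times> carrier G" ?f, OF this]
  show ?thesis by (simp add: free_to_Nab_def[abs_def] Let_def case_prod_unfold)
qed

sublocale phi: group_hom A RM \<phi>
  using phi_hom by (simp add: group_hom_def group_hom_axioms_def)

lemma phi_closed: "Poly_Mapping.keys c \<subseteq> R \<times> carrier G \<Longrightarrow> \<phi> c \<in> carrier RM"
  using phi.hom_closed by simp

lemma phi_add: "Poly_Mapping.keys c \<subseteq> R \<times> carrier G \<Longrightarrow> Poly_Mapping.keys d \<subseteq> R \<times> carrier G
    \<Longrightarrow> \<phi> (c + d) = \<phi> c \<otimes>\<^bsub>RM\<^esub> \<phi> d"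
  using phi.hom_mult[of c d] by simp

lemma phi_minus: "Poly_Mapping.keys c \<subseteq> R \<times> carrier G \<Longrightarrow> \<phi> (- c) = inv\<^bsub>RM\<^esub> \<phi> c"
  using phi.hom_inv[of c] by simp

lemma phi_frag_of:
  assumes "s \<in> R" "g \<in> carrier G"
  shows "\<phi> (frag_of (s, g)) = ract RM (cls (relator s)) g"
proof -
  have "ract RM (cls (relator s)) g \<in> carrier RM"
    using assms by (intro ract_RM_closed) (simp_all add: relator_in_N)
  then show ?thesis by (simp add: free_to_Nab_def Let_def RM.finprod_singleton)
qed

lemma keys_ract_FM:
  assumes "Poly_Mapping.keys c \<subseteq> R \<times> carrier G" "g \<in> carrier G"
  shows "Poly_Mapping.keys (ract FM c g) \<subseteq> R \<times> carrier G"
  using hom_in_carrier[OF frag_extend_hom[of "R \<times> carrier G" "\<lambda>(s, h). frag_of (s, h \<otimes>\<^bsub>G\<^esub> g)"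
      "R \<times> carrier G"], of c] assms by auto

text \<open>Both sides are homomorphisms in \<open>c\<close>, so it suffices to compare them on
  basis elements, where the equation is the action law of \<open>N^ab\<close>.\<close>

lemma phi_ract:
  assumes "Poly_Mapping.keys c \<subseteq> R \<times> carrier G" "g \<in> carrier G"
  shows "\<phi> (ract FM c g) = ract RM (\<phi> c) g"
proof (rule hom_free_Abelian_group_eq[where f = "\<lambda>c. \<phi> (ract FM c g)" and h = "\<lambda>c. ract RM (\<phi> c) g",
      OF RM.is_group _ _ _ assms(1)])
  have "ract FM c g = (\<lambda>c. frag_extend (\<lambda>(s, h). frag_of (s, h \<otimes>\<^bsub>G\<^esub> g)) c) c" for c by simp
  have "(\<lambda>c. ract FM c g) \<in> hom A A"
    unfolding FM_simps using assms(2) by (intro frag_extend_hom) auto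
  from hom_compose[OF this phi_hom] show "(\<lambda>c. \<phi> (ract FM c g)) \<in> hom A RM" by (simp add: comp_def)
  from hom_compose[OF phi_hom ract_RM_hom[OF assms(2)]]
  show "(\<lambda>c. ract RM (\<phi> c) g) \<in> hom A RM" by (simp add: comp_def)
  fix x assume "x \<in> R \<times> carrier G"
  then show "\<phi> (ract FM (frag_of x) g) = ract RM (\<phi> (frag_of x)) g"
    using assms(2) by (auto simp: phi_frag_of ract_RM_mult relator_in_N)
qed

end

section \<open>Homotopies of paths\<close>

definition inv_path :: "'e path \<Rightarrow> 'e path" where
  "inv_path \<gamma> = rev (map reverse \<gamma>)"

lemma reverse_reverse [simp]: "reverse (reverse d) = d"
  by (simp add: reverse_def)

lemma inv_path_simps [simp]:
  "inv_path [] = []" "inv_path (d # \<gamma>) = inv_path \<gamma> @ [reverse d]"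
  "inv_path (inv_path \<gamma>) = \<gamma>"
  by (simp_all add: inv_path_def rev_map comp_def)

text \<open>The record does not tie the ends of edges to \<open>vertices\<close>, and
  \<open>is_path\<close> tests membership only at the final vertex. With these assumptions every
  point visited is a vertex, so paths can be cut and reversed.\<close>

locale wf_complex =
  fixes K :: "('v, 'e) two_complex"
  assumes src_vertex: "e \<in> edges K \<Longrightarrow> src K e \<in> vertices K"
    and tgt_vertex: "e \<in> edges K \<Longrightarrow> tgt K e \<in> vertices K"
begin

lemma dsrc_vertex: "fst d \<in> edges K \<Longrightarrow> dsrc K d \<in> vertices K"
  by (simp add: dsrc_def src_vertex tgt_vertex)

lemma dtgt_vertex: "fst d \<in> edges K \<Longrightarrow> dtgt K d \<in> vertices K"
  by (simp add: dtgt_def src_vertex tgt_vertex)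

lemma reverse_simps [simp]:
  "fst (reverse d) = fst d" "dsrc K (reverse d) = dtgt K d" "dtgt K (reverse d) = dsrc K d"
  by (auto simp: reverse_def dsrc_def dtgt_def)

lemma is_path_vertices: "is_path K u \<gamma> v \<Longrightarrow> u \<in> vertices K \<and> v \<in> vertices K"
  by (induction \<gamma> arbitrary: u) (auto simp: dsrc_vertex)

lemma is_path_append: "is_path K u (\<gamma> @ \<delta>) w \<longleftrightarrow> (\<exists>v. is_path K u \<gamma> v \<and> is_path K v \<delta> w)"
  by (induction \<gamma> arbitrary: u) (auto dest: is_path_vertices)

lemma is_path_appendI: "is_path K u \<gamma> v \<Longrightarrow> is_path K v \<delta> w \<Longrightarrow> is_path K u (\<gamma> @ \<delta>) w"
  by (auto simp: is_path_append)

lemma is_path_inv: "is_path K u \<gamma> v \<Longrightarrow> is_path K v (inv_path \<gamma>) u"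
  by (induction \<gamma> arbitrary: u) (auto simp: is_path_append dsrc_vertex)

lemma homotopic_is_path: "homotopic K u v \<gamma> \<delta> \<Longrightarrow> is_path K u \<gamma> v \<and> is_path K u \<delta> v"
  by (induction rule: homotopic.induct) auto

text \<open>Whiskering: each elementary move already happens between arbitrary paths before and
  after it, and these absorb \<alpha> and \<beta>.\<close>

lemma homotopic_extend:
  assumes "homotopic K u v \<gamma> \<delta>" "is_path K u' \<alpha> u" "is_path K v \<beta> w"
  shows "homotopic K u' w (\<alpha> @ \<gamma> @ \<beta>) (\<alpha> @ \<delta> @ \<beta>)"
  using assms(1)
proof induction
  case (refl \<gamma>)
  then show ?case using assms by (intro homotopic.refl) (auto intro: is_path_appendI)
next
  case (cancel \<gamma> d \<delta>)
  have "is_path K u' ((\<alpha> @ \<gamma>) @ [d, reverse d] @ (\<delta> @ \<beta>)) w"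
    "is_path K u' ((\<alpha> @ \<gamma>) @ (\<delta> @ \<beta>)) w"
    using is_path_appendI[OF assms(2) is_path_appendI[OF cancel(1) assms(3)]]
      is_path_appendI[OF assms(2) is_path_appendI[OF cancel(2) assms(3)]] by simp_all
  then show ?case using homotopic.cancel[of K u' "\<alpha> @ \<gamma>" d "\<delta> @ \<beta>" w] by simp
next
  case (cell \<sigma> \<tau> \<gamma> \<delta>)
  have "is_path K u' ((\<alpha> @ \<gamma>) @ \<sigma> @ (\<delta> @ \<beta>)) w" "is_path K u' ((\<alpha> @ \<gamma>) @ \<tau> @ (\<delta> @ \<beta>)) w"
    using is_path_appendI[OF assms(2) is_path_appendI[OF cell(2) assms(3)]]
      is_path_appendI[OF assms(2) is_path_appendI[OF cell(3) assms(3)]] by simp_all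
  then show ?case using homotopic.cell[OF cell(1), of u' "\<alpha> @ \<gamma>" "\<delta> @ \<beta>" w] by simp
qed (blast intro: homotopic.sym homotopic.trans)+

lemma homotopic_append_left:
  "homotopic K u v \<gamma> \<delta> \<Longrightarrow> is_path K u' \<alpha> u \<Longrightarrow> homotopic K u' v (\<alpha> @ \<gamma>) (\<alpha> @ \<delta>)"
  using homotopic_extend[of u v \<gamma> \<delta> u' \<alpha> "[]" v] homotopic_is_path[of u v \<gamma> \<delta>] is_path_vertices[of u \<gamma> v]
  by simp

lemma homotopic_append_right:
  "homotopic K u v \<gamma> \<delta> \<Longrightarrow> is_path K v \<beta> w \<Longrightarrow> homotopic K u w (\<gamma> @ \<beta>) (\<delta> @ \<beta>)"
  using homotopic_extend[of u v \<gamma> \<delta> u "[]" \<beta> w] homotopic_is_path[of u v \<gamma> \<delta>] is_path_vertices[of u \<gamma> v]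
  by simp

lemma homotopic_append_cong:
  assumes "homotopic K u v \<gamma> \<gamma>'" "homotopic K v w \<delta> \<delta>'"
  shows "homotopic K u w (\<gamma> @ \<delta>) (\<gamma>' @ \<delta>')"
proof (rule homotopic.trans)
  show "homotopic K u w (\<gamma> @ \<delta>) (\<gamma>' @ \<delta>)"
    using assms homotopic_is_path by (blast intro: homotopic_append_right)
  show "homotopic K u w (\<gamma>' @ \<delta>) (\<gamma>' @ \<delta>')"
    using assms homotopic_is_path by (blast intro: homotopic_append_left)
qed

lemma homotopic_inv_right: "is_path K u \<gamma> v \<Longrightarrow> homotopic K u u (\<gamma> @ inv_path \<gamma>) []"
proof (induction \<gamma> arbitrary: u)
  case Nil
  then show ?case by (auto intro: homotopic.refl)
next
  case (Cons d \<gamma>)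
  let ?w = "dtgt K d"
  have d: "fst d \<in> edges K" "dsrc K d = u" "is_path K ?w \<gamma> v" using Cons.prems by auto
  have p: "is_path K u [d] ?w" "is_path K ?w [reverse d] u" "u \<in> vertices K"
    using d by (auto simp: dsrc_vertex dtgt_vertex)
  have "homotopic K u u ([d] @ (\<gamma> @ inv_path \<gamma>) @ [reverse d]) ([d] @ [] @ [reverse d])"
    by (rule homotopic_extend[OF Cons.IH[OF d(3)] p(1,2)])
  moreover have "homotopic K u u ([d] @ [reverse d]) []"
    using homotopic.cancel[of K u "[]" d "[]" u] is_path_appendI[OF p(1,2)] p by simp
  ultimately show ?case by (auto intro: homotopic.trans)
qed

lemma homotopic_inv_left: "is_path K u \<gamma> v \<Longrightarrow> homotopic K v v (inv_path \<gamma> @ \<gamma>) []"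
  using homotopic_inv_right[OF is_path_inv] by simp

lemma homotopic_cancel_left:
  assumes "homotopic K u w (\<alpha> @ \<gamma>) (\<alpha> @ \<delta>)" "is_path K u \<alpha> v" "is_path K v \<gamma> w" "is_path K v \<delta> w"
  shows "homotopic K v w \<gamma> \<delta>"
proof -
  have "homotopic K v w (inv_path \<alpha> @ \<alpha> @ \<gamma>) (inv_path \<alpha> @ \<alpha> @ \<delta>)"
    using homotopic_append_left[OF assms(1) is_path_inv[OF assms(2)]] by simp
  moreover have "homotopic K v w (inv_path \<alpha> @ \<alpha> @ \<epsilon>) \<epsilon>" if "is_path K v \<epsilon> w" for \<epsilon>
    using homotopic_append_right[OF homotopic_inv_left[OF assms(2)] that] by simp
  ultimately show ?thesis using assms(3,4) by (blast intro: homotopic.sym homotopic.trans)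
qed

text \<open>Composing a square with the inverse of \<open>a\<close> in front and of \<open>d\<close>
  behind gives the square read from another corner. This extends the interchange law from forward to
  backward edges.\<close>

lemma homotopic_square_invert:
  assumes h: "homotopic K x w (a @ b) (c @ d)"
    and p: "is_path K x a y" "is_path K y b w" "is_path K x c z" "is_path K z d w"
  shows "homotopic K y z (inv_path a @ c) (b @ inv_path d)"
proof -
  have "homotopic K y z (inv_path a @ (a @ b) @ inv_path d) (inv_path a @ (c @ d) @ inv_path d)"
    by (rule homotopic_extend[OF h is_path_inv[OF p(1)] is_path_inv[OF p(4)]])
  moreover have "homotopic K y z (inv_path a @ (a @ b) @ inv_path d) (b @ inv_path d)"
    using homotopic_append_right[OF homotopic_inv_left[OF p(1)]
        is_path_appendI[OF p(2) is_path_inv[OF p(4)]]] by simp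
  moreover have "homotopic K y z (inv_path a @ (c @ d) @ inv_path d) (inv_path a @ c)"
    using homotopic_append_left[OF homotopic_inv_right[OF p(4)]
        is_path_appendI[OF is_path_inv[OF p(1)] p(3)]] by simp
  ultimately show ?thesis by (blast intro: homotopic.sym homotopic.trans)
qed

lemma homotopy_class_eq:
  "homotopic K u v \<gamma> \<delta> \<Longrightarrow> homotopy_class K u v \<gamma> = homotopy_class K u v \<delta>"
  unfolding homotopy_class_def by (blast intro: homotopic.sym homotopic.trans)

lemma in_homotopy_class: "\<delta> \<in> homotopy_class K u v \<gamma> \<longleftrightarrow> homotopic K u v \<gamma> \<delta>"
  by (simp add: homotopy_class_def)

lemma on_homotopy_class:
  assumes "is_path K u \<gamma> v" "\<And>\<delta>. homotopic K u v \<gamma> \<delta> \<Longrightarrow> f \<delta> = f \<gamma>"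
  shows "on_class f (homotopy_class K u v \<gamma>) = f \<gamma>"
  using assms by (intro on_class_eq) (auto simp: in_homotopy_class intro: homotopic.refl)

lemma fundamental_group_mult:
  assumes "is_path K v \<gamma> v" "is_path K v \<delta> v"
  shows "homotopy_class K v v \<gamma> \<otimes>\<^bsub>fundamental_group K v\<^esub> homotopy_class K v v \<delta>
    = homotopy_class K v v (\<gamma> @ \<delta>)"
proof -
  have "on_class (\<lambda>(\<gamma>, \<delta>). homotopy_class K v v (\<gamma> @ \<delta>))
      (homotopy_class K v v \<gamma> \<times> homotopy_class K v v \<delta>)
    = (\<lambda>(\<gamma>, \<delta>). homotopy_class K v v (\<gamma> @ \<delta>)) (\<gamma>, \<delta>)"
    using assms
    by (intro on_class_eq)
      (auto simp: in_homotopy_class intro: homotopic.refl homotopic.sym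
        intro!: homotopy_class_eq homotopic_append_cong)
  then show ?thesis by (simp add: fundamental_group_def)
qed

end

section \<open>The reduced Squier complex\<close>

context presentation
begin

abbreviation "K \<equiv> squier_complex X R"

lemma K_simps:
  "vertices K = carrier F"
  "(p, l, r, q) \<in> edges K \<longleftrightarrow> p \<in> carrier F \<and> q \<in> carrier F \<and> (l, r) \<in> R"
  "src K (p, l, r, q) = p \<otimes>\<^bsub>F\<^esub> rho l \<otimes>\<^bsub>F\<^esub> q" "tgt K (p, l, r, q) = p \<otimes>\<^bsub>F\<^esub> rho r \<otimes>\<^bsub>F\<^esub> q"
  by (simp_all add: squier_complex_def Let_def)

sublocale K: wf_complex K
  by unfold_locales (auto simp: K_simps rho_closed)

lemma cell_intro:
  assumes "p \<in> carrier F" "q \<in> carrier F" "p' \<in> carrier F" "q' \<in> carrier F"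
    "(l, r) \<in> R" "(l', r') \<in> R"
  shows "([((p, l, r, q \<otimes>\<^bsub>F\<^esub> p' \<otimes>\<^bsub>F\<^esub> rho l' \<otimes>\<^bsub>F\<^esub> q'), True),
       ((p \<otimes>\<^bsub>F\<^esub> rho r \<otimes>\<^bsub>F\<^esub> q \<otimes>\<^bsub>F\<^esub> p', l', r', q'), True)],
      [((p \<otimes>\<^bsub>F\<^esub> rho l \<otimes>\<^bsub>F\<^esub> q \<otimes>\<^bsub>F\<^esub> p', l', r', q'), True),
       ((p, l, r, q \<otimes>\<^bsub>F\<^esub> p' \<otimes>\<^bsub>F\<^esub> rho r' \<otimes>\<^bsub>F\<^esub> q'), True)]) \<in> cells K"
  using assms unfolding squier_complex_def Let_def by auto

lemma cell_cases:
  assumes "(\<sigma>, \<tau>) \<in> cells K"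
  obtains p q p' q' l r l' r' where
    "p \<in> carrier F" "q \<in> carrier F" "p' \<in> carrier F" "q' \<in> carrier F" "(l, r) \<in> R" "(l', r') \<in> R"
    "\<sigma> = [((p, l, r, q \<otimes>\<^bsub>F\<^esub> p' \<otimes>\<^bsub>F\<^esub> rho l' \<otimes>\<^bsub>F\<^esub> q'), True),
       ((p \<otimes>\<^bsub>F\<^esub> rho r \<otimes>\<^bsub>F\<^esub> q \<otimes>\<^bsub>F\<^esub> p', l', r', q'), True)]"
    "\<tau> = [((p \<otimes>\<^bsub>F\<^esub> rho l \<otimes>\<^bsub>F\<^esub> q \<otimes>\<^bsub>F\<^esub> p', l', r', q'), True),
       ((p, l, r, q \<otimes>\<^bsub>F\<^esub> p' \<otimes>\<^bsub>F\<^esub> rho r' \<otimes>\<^bsub>F\<^esub> q'), True)]"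
  using assms unfolding squier_complex_def Let_def by auto

section \<open>Translation and interchange of paths\<close>

abbreviation "lpath \<equiv> left_act X"
abbreviation "rpath \<equiv> right_act X"

lemma act_simps [simp]:
  "lpath u [] = []" "lpath u (((p, l, r, q), b) # \<gamma>) = ((u \<otimes>\<^bsub>F\<^esub> p, l, r, q), b) # lpath u \<gamma>"
  "lpath u (\<gamma> @ \<delta>) = lpath u \<gamma> @ lpath u \<delta>"
  "rpath [] v = []" "rpath (((p, l, r, q), b) # \<gamma>) v = ((p, l, r, q \<otimes>\<^bsub>F\<^esub> v), b) # rpath \<gamma> v"
  "rpath (\<gamma> @ \<delta>) v = rpath \<gamma> v @ rpath \<delta> v"
  by (simp_all add: left_act_def right_act_def)

text \<open>Translations act on paths, so the translate of one directed edge is reached as the head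
  of a path of length one. In this form the move that cancels an edge against its reverse can be
  translated.\<close>

lemma act_reverse:
  "lpath u [reverse d] = [reverse (hd (lpath u [d]))]" "lpath u [d] = [hd (lpath u [d])]"
  "rpath [reverse d] v = [reverse (hd (rpath [d] v))]" "rpath [d] v = [hd (rpath [d] v)]"
  by (cases d; auto simp: left_act_def right_act_def reverse_def)+

lemma act_inv_path:
  "lpath u (inv_path \<gamma>) = inv_path (lpath u \<gamma>)" "rpath (inv_path \<gamma>) v = inv_path (rpath \<gamma> v)"
  by (auto simp: left_act_def right_act_def inv_path_def reverse_def rev_map case_prod_unfold)

lemma is_path_lpath:
  assumes "is_path K u \<gamma> v" "x \<in> carrier F"
  shows "is_path K (x \<otimes>\<^bsub>F\<^esub> u) (lpath x \<gamma>) (x \<otimes>\<^bsub>F\<^esub> v)"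
  using assms(1)
proof (induction \<gamma> arbitrary: u)
  case (Cons d \<gamma>)
  obtain p l r q b where d: "d = ((p, l, r, q), b)" by (metis prod.exhaust)
  with Cons.prems have pq: "p \<in> carrier F" "q \<in> carrier F" "(l, r) \<in> R" by (auto simp: K_simps)
  note cl = pq assms(2) rho_closed[OF pq(3)]
  show ?case using Cons.prems Cons.IH[of "dtgt K d"] cl
    by (auto simp: d K_simps dsrc_def dtgt_def F.m_assoc split: if_splits)
qed (use assms(2) in \<open>auto simp: K_simps\<close>)

lemma is_path_rpath:
  assumes "is_path K u \<gamma> v" "x \<in> carrier F"
  shows "is_path K (u \<otimes>\<^bsub>F\<^esub> x) (rpath \<gamma> x) (v \<otimes>\<^bsub>F\<^esub> x)"
  using assms(1)
proof (induction \<gamma> arbitrary: u)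
  case (Cons d \<gamma>)
  obtain p l r q b where d: "d = ((p, l, r, q), b)" by (metis prod.exhaust)
  with Cons.prems have pq: "p \<in> carrier F" "q \<in> carrier F" "(l, r) \<in> R" by (auto simp: K_simps)
  note cl = pq assms(2) rho_closed[OF pq(3)]
  show ?case using Cons.prems Cons.IH[of "dtgt K d"] cl
    by (auto simp: d K_simps dsrc_def dtgt_def F.m_assoc split: if_splits)
qed (use assms(2) in \<open>auto simp: K_simps\<close>)

lemma lpath_cell:
  assumes "(\<sigma>, \<tau>) \<in> cells K" "x \<in> carrier F"
  shows "(lpath x \<sigma>, lpath x \<tau>) \<in> cells K"
  using assms(1)
proof (cases rule: cell_cases)
  case (1 p q p' q' l r l' r')
  note cl = 1(1-6) assms(2) rho_closed[OF 1(5)] rho_closed[OF 1(6)]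
  show ?thesis using cell_intro[of "x \<otimes>\<^bsub>F\<^esub> p" q p' q' l r l' r'] cl by (simp add: 1(7,8) F.m_assoc)
qed

lemma rpath_cell:
  assumes "(\<sigma>, \<tau>) \<in> cells K" "x \<in> carrier F"
  shows "(rpath \<sigma> x, rpath \<tau> x) \<in> cells K"
  using assms(1)
proof (cases rule: cell_cases)
  case (1 p q p' q' l r l' r')
  note cl = 1(1-6) assms(2) rho_closed[OF 1(5)] rho_closed[OF 1(6)]
  show ?thesis using cell_intro[of p q p' "q' \<otimes>\<^bsub>F\<^esub> x" l r l' r'] cl by (simp add: 1(7,8) F.m_assoc)
qed

lemma homotopic_lpath:
  assumes "homotopic K u v \<gamma> \<delta>" "x \<in> carrier F"
  shows "homotopic K (x \<otimes>\<^bsub>F\<^esub> u) (x \<otimes>\<^bsub>F\<^esub> v) (lpath x \<gamma>) (lpath x \<delta>)"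
  using assms(1)
proof induction
  case (refl \<gamma>)
  then show ?case using assms(2) by (intro homotopic.refl is_path_lpath)
next
  case (cancel \<gamma> d \<delta>)
  have "lpath x [d, reverse d] = [hd (lpath x [d]), reverse (hd (lpath x [d]))]"
    using act_simps(3)[of x "[d]" "[reverse d]"] act_reverse(1,2)[of x d] by simp
  then show ?case
    using homotopic.cancel[of K "x \<otimes>\<^bsub>F\<^esub> u" "lpath x \<gamma>" "hd (lpath x [d])" "lpath x \<delta>" "x \<otimes>\<^bsub>F\<^esub> v"]
      is_path_lpath[OF cancel(1) assms(2)] is_path_lpath[OF cancel(2) assms(2)]
    by (simp only: act_simps(3))
next
  case (cell \<sigma> \<tau> \<gamma> \<delta>)
  then show ?case
    using homotopic.cell[OF lpath_cell[OF cell(1) assms(2)], of _ "lpath x \<gamma>" "lpath x \<delta>"]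
      is_path_lpath[OF cell(2) assms(2)] is_path_lpath[OF cell(3) assms(2)] by simp
qed (blast intro: homotopic.sym homotopic.trans)+

lemma homotopic_rpath:
  assumes "homotopic K u v \<gamma> \<delta>" "x \<in> carrier F"
  shows "homotopic K (u \<otimes>\<^bsub>F\<^esub> x) (v \<otimes>\<^bsub>F\<^esub> x) (rpath \<gamma> x) (rpath \<delta> x)"
  using assms(1)
proof induction
  case (refl \<gamma>)
  then show ?case using assms(2) by (intro homotopic.refl is_path_rpath)
next
  case (cancel \<gamma> d \<delta>)
  have "rpath [d, reverse d] x = [hd (rpath [d] x), reverse (hd (rpath [d] x))]"
    using act_simps(6)[of "[d]" "[reverse d]" x] act_reverse(3,4)[of d x] by simp
  then show ?case
    using homotopic.cancel[of K "u \<otimes>\<^bsub>F\<^esub> x" "rpath \<gamma> x" "hd (rpath [d] x)" "rpath \<delta> x" "v \<otimes>\<^bsub>F\<^esub> x"]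
      is_path_rpath[OF cancel(1) assms(2)] is_path_rpath[OF cancel(2) assms(2)]
    by (simp only: act_simps(6))
next
  case (cell \<sigma> \<tau> \<gamma> \<delta>)
  then show ?case
    using homotopic.cell[OF rpath_cell[OF cell(1) assms(2)], of _ "rpath \<gamma> x" "rpath \<delta> x"]
      is_path_rpath[OF cell(2) assms(2)] is_path_rpath[OF cell(3) assms(2)] by simp
qed (blast intro: homotopic.sym homotopic.trans)+

text \<open>The path hypothesis puts the words \<open>p\<close> and \<open>q\<close> of all edges
  into \<open>carrier F\<close>, where the group laws apply.\<close>

lemma act_comp:
  assumes "is_path K u \<gamma> v" "x \<in> carrier F" "y \<in> carrier F"
  shows "lpath x (lpath y \<gamma>) = lpath (x \<otimes>\<^bsub>F\<^esub> y) \<gamma>" "rpath (rpath \<gamma> x) y = rpath \<gamma> (x \<otimes>\<^bsub>F\<^esub> y)"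
    "lpath \<one>\<^bsub>F\<^esub> \<gamma> = \<gamma>" "rpath \<gamma> \<one>\<^bsub>F\<^esub> = \<gamma>" "lpath x (rpath \<gamma> y) = rpath (lpath x \<gamma>) y"
  using assms(1)
  by (induction \<gamma> arbitrary: u) (use assms(2,3) in \<open>auto simp: K_simps F.m_assoc\<close>)

text \<open>The product square of two paths: running \<gamma> in the left factor and then \<delta>
  in the right one is homotopic to the opposite order. The end points are quantified because the
  empty path does not determine its own.\<close>

definition exchange :: "'x squier_edge path \<Rightarrow> 'x squier_edge path \<Rightarrow> bool" where
  "exchange \<gamma> \<delta> \<longleftrightarrow> (\<forall>u v u' v'. is_path K u \<gamma> v \<longrightarrow> is_path K u' \<delta> v' \<longrightarrow>
    homotopic K (u \<otimes>\<^bsub>F\<^esub> u') (v \<otimes>\<^bsub>F\<^esub> v')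
      (rpath \<gamma> u' @ lpath v \<delta>) (lpath u \<delta> @ rpath \<gamma> v'))"

lemma exchangeD:
  "exchange \<gamma> \<delta> \<Longrightarrow> is_path K u \<gamma> v \<Longrightarrow> is_path K u' \<delta> v' \<Longrightarrow>
    homotopic K (u \<otimes>\<^bsub>F\<^esub> u') (v \<otimes>\<^bsub>F\<^esub> v') (rpath \<gamma> u' @ lpath v \<delta>) (lpath u \<delta> @ rpath \<gamma> v')"
  by (simp add: exchange_def)

lemma vertex_carrier: "is_path K u \<gamma> v \<Longrightarrow> u \<in> carrier F" "is_path K u \<gamma> v \<Longrightarrow> v \<in> carrier F"
  using K.is_path_vertices by (auto simp: K_simps)

lemma exchange_inv_left:
  assumes "exchange \<gamma> \<delta>"
  shows "exchange (inv_path \<gamma>) \<delta>"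
  unfolding exchange_def
proof (intro allI impI)
  fix u v u' v'
  assume p: "is_path K u (inv_path \<gamma>) v" "is_path K u' \<delta> v'"
  then have g: "is_path K v \<gamma> u" using K.is_path_inv by fastforce
  note cl = vertex_carrier[OF p(1)] vertex_carrier[OF p(2)]
  show "homotopic K (u \<otimes>\<^bsub>F\<^esub> u') (v \<otimes>\<^bsub>F\<^esub> v')
      (rpath (inv_path \<gamma>) u' @ lpath v \<delta>) (lpath u \<delta> @ rpath (inv_path \<gamma>) v')"
    unfolding act_inv_path
    by (rule K.homotopic_square_invert[OF exchangeD[OF assms g p(2)]])
      (use cl g p(2) in \<open>auto intro: is_path_rpath is_path_lpath\<close>)
qed

lemma exchange_inv_right:
  assumes "exchange \<gamma> \<delta>"
  shows "exchange \<gamma> (inv_path \<delta>)"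
  unfolding exchange_def
proof (intro allI impI)
  fix u v u' v'
  assume p: "is_path K u \<gamma> v" "is_path K u' (inv_path \<delta>) v'"
  then have d: "is_path K v' \<delta> u'" using K.is_path_inv by fastforce
  note cl = vertex_carrier[OF p(1)] vertex_carrier[OF p(2)]
  have "homotopic K (u \<otimes>\<^bsub>F\<^esub> u') (v \<otimes>\<^bsub>F\<^esub> v')
      (inv_path (lpath u \<delta>) @ rpath \<gamma> v') (rpath \<gamma> u' @ inv_path (lpath v \<delta>))"
    by (rule K.homotopic_square_invert[OF homotopic.sym[OF exchangeD[OF assms p(1) d]]])
      (use cl d p(1) in \<open>auto intro: is_path_rpath is_path_lpath\<close>)
  then show "homotopic K (u \<otimes>\<^bsub>F\<^esub> u') (v \<otimes>\<^bsub>F\<^esub> v')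
      (rpath \<gamma> u' @ lpath v (inv_path \<delta>)) (lpath u (inv_path \<delta>) @ rpath \<gamma> v')"
    unfolding act_inv_path by (rule homotopic.sym)
qed

text \<open>For two forward edges the square is a defining 2-cell, once the end points are written
  as products p l q and p r q and reassociated.\<close>

lemma exchange_forward: "exchange [(e, True)] [(e', True)]"
  unfolding exchange_def
proof (intro allI impI)
  fix u v u' v'
  assume p: "is_path K u [(e, True)] v" "is_path K u' [(e', True)] v'"
  obtain x l r q where e: "e = (x, l, r, q)" by (metis prod.exhaust)
  obtain x' l' r' q' where e': "e' = (x', l', r', q')" by (metis prod.exhaust)
  have f: "x \<in> carrier F" "q \<in> carrier F" "(l, r) \<in> R" "x' \<in> carrier F" "q' \<in> carrier F" "(l', r') \<in> R"
    using p by (auto simp: e e' K_simps)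
  have uv: "u = x \<otimes>\<^bsub>F\<^esub> rho l \<otimes>\<^bsub>F\<^esub> q" "v = x \<otimes>\<^bsub>F\<^esub> rho r \<otimes>\<^bsub>F\<^esub> q"
    "u' = x' \<otimes>\<^bsub>F\<^esub> rho l' \<otimes>\<^bsub>F\<^esub> q'" "v' = x' \<otimes>\<^bsub>F\<^esub> rho r' \<otimes>\<^bsub>F\<^esub> q'"
    using p by (auto simp: e e' K_simps dsrc_def dtgt_def)
  note cl = f rho_closed[OF f(3)] rho_closed[OF f(6)] vertex_carrier[OF p(1)] vertex_carrier[OF p(2)]
  have c: "(rpath [(e, True)] u' @ lpath v [(e', True)], lpath u [(e', True)] @ rpath [(e, True)] v')
      \<in> cells K"
    using cell_intro[of x q x' q' l r l' r'] cl by (simp add: e e' uv F.m_assoc)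
  have "is_path K (u \<otimes>\<^bsub>F\<^esub> u') (rpath [(e, True)] u' @ lpath v [(e', True)]) (v \<otimes>\<^bsub>F\<^esub> v')"
    "is_path K (u \<otimes>\<^bsub>F\<^esub> u') (lpath u [(e', True)] @ rpath [(e, True)] v') (v \<otimes>\<^bsub>F\<^esub> v')"
    using cl by (blast intro: K.is_path_appendI[OF is_path_rpath[OF p(1)] is_path_lpath[OF p(2)]]
      K.is_path_appendI[OF is_path_lpath[OF p(2)] is_path_rpath[OF p(1)]])+
  then show "homotopic K (u \<otimes>\<^bsub>F\<^esub> u') (v \<otimes>\<^bsub>F\<^esub> v')
      (rpath [(e, True)] u' @ lpath v [(e', True)]) (lpath u [(e', True)] @ rpath [(e, True)] v')"
    using homotopic.cell[OF c, of _ "[]" "[]"] by simp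
qed

lemma exchange_edges: "exchange [(e, b)] [(e', b')]"
proof -
  have "exchange [(e, True)] [(e', b')]"
    using exchange_forward[of e e'] exchange_inv_right[OF exchange_forward, of e e']
    by (cases b') (simp_all add: reverse_def)
  then show ?thesis
    using exchange_inv_left[of "[(e, True)]" "[(e', b')]"] by (cases b) (simp_all add: reverse_def)
qed

text \<open>Two squares are pasted along their common side \<open>lpath w \<delta>\<close>, where
  \<open>w\<close> is the vertex between the two pieces.\<close>

lemma exchange_append_left:
  assumes "exchange \<gamma>1 \<delta>" "exchange \<gamma>2 \<delta>"
  shows "exchange (\<gamma>1 @ \<gamma>2) \<delta>"
  unfolding exchange_def
proof (intro allI impI)
  fix u v u' v'
  assume p: "is_path K u (\<gamma>1 @ \<gamma>2) v" "is_path K u' \<delta> v'"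
  then obtain w where w: "is_path K u \<gamma>1 w" "is_path K w \<gamma>2 v" by (auto simp: K.is_path_append)
  note cl = vertex_carrier[OF p(2)] vertex_carrier[OF w(1)] vertex_carrier[OF w(2)]
  have "homotopic K (u \<otimes>\<^bsub>F\<^esub> u') (v \<otimes>\<^bsub>F\<^esub> v')
      (rpath \<gamma>1 u' @ (rpath \<gamma>2 u' @ lpath v \<delta>)) (rpath \<gamma>1 u' @ (lpath w \<delta> @ rpath \<gamma>2 v'))"
    using exchangeD[OF assms(2) w(2) p(2)] is_path_rpath[OF w(1) cl(1)]
    by (rule K.homotopic_append_left)
  moreover have "homotopic K (u \<otimes>\<^bsub>F\<^esub> u') (v \<otimes>\<^bsub>F\<^esub> v')
      ((rpath \<gamma>1 u' @ lpath w \<delta>) @ rpath \<gamma>2 v') ((lpath u \<delta> @ rpath \<gamma>1 v') @ rpath \<gamma>2 v')"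
    using exchangeD[OF assms(1) w(1) p(2)] is_path_rpath[OF w(2) cl(2)]
    by (rule K.homotopic_append_right)
  ultimately show "homotopic K (u \<otimes>\<^bsub>F\<^esub> u') (v \<otimes>\<^bsub>F\<^esub> v')
      (rpath (\<gamma>1 @ \<gamma>2) u' @ lpath v \<delta>) (lpath u \<delta> @ rpath (\<gamma>1 @ \<gamma>2) v')"
    by (auto intro: homotopic.trans)
qed

lemma exchange_append_right:
  assumes "exchange \<gamma> \<delta>1" "exchange \<gamma> \<delta>2"
  shows "exchange \<gamma> (\<delta>1 @ \<delta>2)"
  unfolding exchange_def
proof (intro allI impI)
  fix u v u' v'
  assume p: "is_path K u \<gamma> v" "is_path K u' (\<delta>1 @ \<delta>2) v'"
  then obtain w where w: "is_path K u' \<delta>1 w" "is_path K w \<delta>2 v'" by (auto simp: K.is_path_append)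
  note cl = vertex_carrier[OF p(1)] vertex_carrier[OF w(1)] vertex_carrier[OF w(2)]
  have "homotopic K (u \<otimes>\<^bsub>F\<^esub> u') (v \<otimes>\<^bsub>F\<^esub> v')
      ((rpath \<gamma> u' @ lpath v \<delta>1) @ lpath v \<delta>2) ((lpath u \<delta>1 @ rpath \<gamma> w) @ lpath v \<delta>2)"
    using exchangeD[OF assms(1) p(1) w(1)] is_path_lpath[OF w(2) cl(2)]
    by (rule K.homotopic_append_right)
  moreover have "homotopic K (u \<otimes>\<^bsub>F\<^esub> u') (v \<otimes>\<^bsub>F\<^esub> v')
      (lpath u \<delta>1 @ (rpath \<gamma> w @ lpath v \<delta>2)) (lpath u \<delta>1 @ (lpath u \<delta>2 @ rpath \<gamma> v'))"
    using exchangeD[OF assms(2) p(1) w(2)] is_path_lpath[OF w(1) cl(1)]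
    by (rule K.homotopic_append_left)
  ultimately show "homotopic K (u \<otimes>\<^bsub>F\<^esub> u') (v \<otimes>\<^bsub>F\<^esub> v')
      (rpath \<gamma> u' @ lpath v (\<delta>1 @ \<delta>2)) (lpath u (\<delta>1 @ \<delta>2) @ rpath \<gamma> v')"
    by (auto intro: homotopic.trans)
qed

lemma exchange_Nil: "exchange [] \<delta>" "exchange \<gamma> []"
  unfolding exchange_def
  by (auto simp: K_simps intro!: homotopic.refl intro: is_path_lpath is_path_rpath)

lemma exchange: "exchange \<gamma> \<delta>"
proof (induction \<gamma>)
  case (Cons d \<gamma>)
  have "exchange [d] \<delta>"
  proof (induction \<delta>)
    case (Cons d' \<delta>)
    then show ?case using exchange_append_right[of "[d]" "[d']" \<delta>] exchange_edges by (cases d; cases d') simp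
  qed (rule exchange_Nil)
  with Cons show ?case using exchange_append_left[of "[d]" \<delta> \<gamma>] by simp
qed (rule exchange_Nil)

lemma conj_path:
  assumes "is_path K \<one>\<^bsub>F\<^esub> \<gamma> \<one>\<^bsub>F\<^esub>" "q \<in> carrier F"
  shows "is_path K \<one>\<^bsub>F\<^esub> (rpath (lpath (inv\<^bsub>F\<^esub> q) \<gamma>) q) \<one>\<^bsub>F\<^esub>"
  using is_path_rpath[OF is_path_lpath[OF assms(1), of "inv\<^bsub>F\<^esub> q"] assms(2)] assms by simp

lemma homotopic_conj:
  assumes "homotopic K \<one>\<^bsub>F\<^esub> \<one>\<^bsub>F\<^esub> \<gamma> \<delta>" "q \<in> carrier F"
  shows "homotopic K \<one>\<^bsub>F\<^esub> \<one>\<^bsub>F\<^esub> (rpath (lpath (inv\<^bsub>F\<^esub> q) \<gamma>) q) (rpath (lpath (inv\<^bsub>F\<^esub> q) \<delta>) q)"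
  using homotopic_rpath[OF homotopic_lpath[OF assms(1), of "inv\<^bsub>F\<^esub> q"] assms(2)] assms by simp

text \<open>
  Exchanging \<open>\<gamma>\<close> with \<open>\<delta>\<close> on either side gives \<open>\<delta> @ (n \<triangleright> \<gamma>) \<simeq> \<gamma> @ \<delta> \<simeq> \<delta> @ (\<gamma> \<triangleleft> n)\<close>; this is why \<open>N\<close> acts
  trivially on the fundamental group.
\<close>

lemma homotopic_conj_connected:
  assumes g: "is_path K \<one>\<^bsub>F\<^esub> \<gamma> \<one>\<^bsub>F\<^esub>" and d: "is_path K \<one>\<^bsub>F\<^esub> \<delta> n"
  shows "homotopic K \<one>\<^bsub>F\<^esub> \<one>\<^bsub>F\<^esub> \<gamma> (rpath (lpath (inv\<^bsub>F\<^esub> n) \<gamma>) n)"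
proof -
  note n = vertex_carrier(2)[OF d]
  have p: "is_path K n (lpath n \<gamma>) n" "is_path K n (rpath \<gamma> n) n"
    using is_path_lpath[OF g n] is_path_rpath[OF g n] n by simp_all
  have "homotopic K \<one>\<^bsub>F\<^esub> n (\<gamma> @ \<delta>) (\<delta> @ rpath \<gamma> n)"
    using exchangeD[OF exchange g d] n by (simp add: act_comp[OF g] act_comp[OF d])
  moreover have "homotopic K \<one>\<^bsub>F\<^esub> n (\<delta> @ lpath n \<gamma>) (\<gamma> @ \<delta>)"
    using exchangeD[OF exchange d g] n by (simp add: act_comp[OF g] act_comp[OF d])
  ultimately have "homotopic K \<one>\<^bsub>F\<^esub> n (\<delta> @ lpath n \<gamma>) (\<delta> @ rpath \<gamma> n)"
    by (blast intro: homotopic.trans)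
  from K.homotopic_cancel_left[OF this d p]
  have "homotopic K n n (lpath n \<gamma>) (rpath \<gamma> n)" .
  from homotopic_lpath[OF this, of "inv\<^bsub>F\<^esub> n"] show ?thesis
    using n by (simp add: act_comp[OF g])
qed

end

section \<open>Exactness of the relation sequence\<close>

context presentation
begin

abbreviation "pc \<equiv> path_contribution X R"

lemma pc_simps [simp]:
  "pc [] = 0"
  "pc (((p, l, r, q), b) # \<gamma>)
    = (if b then frag_of ((l, r), \<theta> q) else - frag_of ((l, r), \<theta> q)) + pc \<gamma>"
  "pc (\<gamma> @ \<delta>) = pc \<gamma> + pc \<delta>"
  by (simp_all add: path_contribution_def)

lemma pc_inv_path: "pc (inv_path \<gamma>) = - pc \<gamma>"
  by (induction \<gamma>) (auto simp: reverse_def)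

text \<open>An edge contributes through its relation and its right factor \<open>q\<close>, while
  left translation alters only \<open>p\<close>.\<close>

lemma pc_lpath: "pc (lpath u \<gamma>) = pc \<gamma>"
  by (induction \<gamma>) auto

lemma pc_rpath:
  assumes "is_path K u \<gamma> v" "x \<in> carrier F"
  shows "pc (rpath \<gamma> x) = ract FM (pc \<gamma>) (\<theta> x)"
  using assms(1)
  by (induction \<gamma> arbitrary: u)
    (use assms(2) in \<open>auto simp: K_simps theta_mult frag_extend_add frag_extend_minus\<close>)

lemma keys_pc: "is_path K u \<gamma> v \<Longrightarrow> Poly_Mapping.keys (pc \<gamma>) \<subseteq> R \<times> carrier G"
proof (induction \<gamma> arbitrary: u)
  case (Cons d \<gamma>)
  obtain p l r q b where d: "d = ((p, l, r, q), b)" by (metis prod.exhaust)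
  with Cons.prems have "q \<in> carrier F" "(l, r) \<in> R" by (auto simp: K_simps)
  then have "Poly_Mapping.keys (pc [d]) \<subseteq> R \<times> carrier G" by (auto simp: d)
  moreover have "pc (d # \<gamma>) = pc [d] + pc \<gamma>" by (simp add: d)
  ultimately show ?case using Cons keys_add[of "pc [d]" "pc \<gamma>"] by fastforce
qed simp

text \<open>Both sides of a 2-cell use the same two relations. The right factors of the
  \<open>(l, r)\<close> edges differ by having l' in place of r', which is invisible in
  \<open>G\<close>.\<close>

lemma pc_homotopic: "homotopic K u v \<gamma> \<delta> \<Longrightarrow> pc \<gamma> = pc \<delta>"
proof (induction rule: homotopic.induct)
  case (cancel \<gamma> d \<delta>)
  have "pc [d, reverse d] = 0" by (cases d) (auto simp: reverse_def)
  then show ?case by (simp only: pc_simps) simp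
next
  case (cell \<sigma> \<tau> \<gamma> \<delta>)
  from cell(1) have "pc \<sigma> = pc \<tau>"
  proof (cases rule: cell_cases)
    case (1 p q p' q' l r l' r')
    then show ?thesis using theta_relation[of l' r' "q \<otimes>\<^bsub>F\<^esub> p'" q'] by simp
  qed
  then show ?case by simp
qed simp_all

text \<open>The quotient of the ends is (p l q)^-1 (p r q) = q^-1 (l^-1 r) q: the factor p cancels,
  and what remains is the relator acted on by q. A backward edge gives the inverse.\<close>

lemma phi_edge:
  assumes "fst d \<in> edges K"
  shows "inv\<^bsub>F\<^esub> dsrc K d \<otimes>\<^bsub>F\<^esub> dtgt K d \<in> N \<and> \<phi> (pc [d]) = cls (inv\<^bsub>F\<^esub> dsrc K d \<otimes>\<^bsub>F\<^esub> dtgt K d)"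
proof -
  obtain p l r q b where d: "d = ((p, l, r, q), b)" by (metis prod.exhaust)
  with assms have f: "p \<in> carrier F" "q \<in> carrier F" "(l, r) \<in> R" by (auto simp: K_simps)
  note cl = f rho_closed[OF f(3)]
  let ?n = "inv\<^bsub>F\<^esub> q \<otimes>\<^bsub>F\<^esub> relator (l, r) \<otimes>\<^bsub>F\<^esub> q"
  have n: "?n \<in> N" using conj_N relator_in_N f by blast
  have phi: "\<phi> (frag_of ((l, r), \<theta> q)) = cls ?n"
    using f by (simp add: phi_frag_of ract_cls relator_in_N)
  show ?thesis
  proof (cases b)
    case True
    then have "inv\<^bsub>F\<^esub> dsrc K d \<otimes>\<^bsub>F\<^esub> dtgt K d = ?n"
      using cl by (simp add: d dsrc_def dtgt_def K_simps relator_eq F.m_assoc F.inv_mult_group F.mult_inv_cancel)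
    with n phi True show ?thesis by (simp add: d)
  next
    case False
    then have eq: "inv\<^bsub>F\<^esub> dsrc K d \<otimes>\<^bsub>F\<^esub> dtgt K d = inv\<^bsub>F\<^esub> ?n"
      using cl by (simp add: d dsrc_def dtgt_def K_simps relator_eq F.m_assoc F.inv_mult_group F.mult_inv_cancel)
    have inv: "inv\<^bsub>F\<^esub> ?n \<in> N" using n by (rule N.m_inv_closed)
    have "cls (inv\<^bsub>F\<^esub> ?n) \<otimes>\<^bsub>RM\<^esub> cls ?n = \<one>\<^bsub>RM\<^esub>"
      using n inv N.mem_carrier[OF n] by (simp only: RM_mult_cls RM_one F.l_inv)
    then have "inv\<^bsub>RM\<^esub> cls ?n = cls (inv\<^bsub>F\<^esub> ?n)"
      using n inv by (intro RM.inv_equality) simp_all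
    moreover have "\<phi> (- frag_of ((l, r), \<theta> q)) = inv\<^bsub>RM\<^esub> \<phi> (frag_of ((l, r), \<theta> q))"
      using f by (intro phi_minus) simp
    ultimately show ?thesis using False eq inv phi by (simp add: d)
  qed
qed

text \<open>The quotients of consecutive vertices telescope, while \<phi> turns the sum of the edge
  contributions into the product of their classes.\<close>

lemma phi_path:
  assumes "is_path K u \<gamma> v"
  shows "inv\<^bsub>F\<^esub> u \<otimes>\<^bsub>F\<^esub> v \<in> N \<and> \<phi> (pc \<gamma>) = cls (inv\<^bsub>F\<^esub> u \<otimes>\<^bsub>F\<^esub> v)"
  using assms
proof (induction \<gamma> arbitrary: u)
  case Nil
  then have "inv\<^bsub>F\<^esub> u \<otimes>\<^bsub>F\<^esub> v = \<one>\<^bsub>F\<^esub>" by (auto simp: K_simps)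
  moreover have "\<phi> 0 = cls \<one>\<^bsub>F\<^esub>" using phi.hom_one by (simp only: one_free_Abelian_group RM_one)
  ultimately show ?case by simp
next
  case (Cons d \<gamma>)
  let ?w = "dtgt K d"
  have d: "fst d \<in> edges K" "dsrc K d = u" "is_path K ?w \<gamma> v" using Cons.prems by auto
  have cl: "u \<in> carrier F" "?w \<in> carrier F" "v \<in> carrier F"
    using vertex_carrier[OF Cons.prems] vertex_carrier[OF d(3)] by auto
  have e: "inv\<^bsub>F\<^esub> u \<otimes>\<^bsub>F\<^esub> ?w \<in> N" "\<phi> (pc [d]) = cls (inv\<^bsub>F\<^esub> u \<otimes>\<^bsub>F\<^esub> ?w)"
    using phi_edge[OF d(1)] d(2) by auto
  have i: "inv\<^bsub>F\<^esub> ?w \<otimes>\<^bsub>F\<^esub> v \<in> N" "\<phi> (pc \<gamma>) = cls (inv\<^bsub>F\<^esub> ?w \<otimes>\<^bsub>F\<^esub> v)"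
    using Cons.IH[OF d(3)] by auto
  have m: "(inv\<^bsub>F\<^esub> u \<otimes>\<^bsub>F\<^esub> ?w) \<otimes>\<^bsub>F\<^esub> (inv\<^bsub>F\<^esub> ?w \<otimes>\<^bsub>F\<^esub> v) = inv\<^bsub>F\<^esub> u \<otimes>\<^bsub>F\<^esub> v"
    using cl by (simp add: F.m_assoc F.mult_inv_cancel)
  have "is_path K u [d] ?w" using d K.dtgt_vertex by simp
  then have "Poly_Mapping.keys (pc [d]) \<subseteq> R \<times> carrier G" by (rule keys_pc)
  then have "\<phi> (pc [d] + pc \<gamma>) = \<phi> (pc [d]) \<otimes>\<^bsub>RM\<^esub> \<phi> (pc \<gamma>)"
    using keys_pc[OF d(3)] by (rule phi_add)
  moreover have "pc (d # \<gamma>) = pc [d] + pc \<gamma>" by (metis append_Cons append_Nil pc_simps(3))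
  ultimately show ?case
    using e i m N.m_closed[OF e(1) i(1)] RM_mult_cls[OF e(1) i(1)] by simp
qed

text \<open>These pairs form a subgroup of the fibre product of \<open>N\<close> and the free module
  over \<open>N^ab\<close>. Working with them reduces exactness to closure properties and keeps
  explicit paths out of the later arguments.\<close>

definition reach :: "'x word \<Rightarrow> ('x relation \<times> 'x word set \<Rightarrow>\<^sub>0 int) \<Rightarrow> bool" where
  "reach n c \<longleftrightarrow> (\<exists>\<gamma>. is_path K \<one>\<^bsub>F\<^esub> \<gamma> n \<and> pc \<gamma> = c)"

lemma reachI: "is_path K \<one>\<^bsub>F\<^esub> \<gamma> n \<Longrightarrow> reach n (pc \<gamma>)"
  by (auto simp: reach_def)

lemma reach_phi:
  assumes "reach n c"
  shows "n \<in> N" "Poly_Mapping.keys c \<subseteq> R \<times> carrier G" "\<phi> c = cls n"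
proof -
  obtain \<gamma> where \<gamma>: "is_path K \<one>\<^bsub>F\<^esub> \<gamma> n" "pc \<gamma> = c" using assms by (auto simp: reach_def)
  show "n \<in> N" "Poly_Mapping.keys c \<subseteq> R \<times> carrier G" "\<phi> c = cls n"
    using \<gamma> phi_path[OF \<gamma>(1)] vertex_carrier(2)[OF \<gamma>(1)] keys_pc[OF \<gamma>(1)] by auto
qed

lemma reach_one: "reach \<one>\<^bsub>F\<^esub> 0"
  using reachI[of "[]"] by (simp add: K_simps)

lemma reach_mult:
  assumes "reach n c" "reach m d"
  shows "reach (n \<otimes>\<^bsub>F\<^esub> m) (c + d)"
proof -
  obtain \<gamma> \<delta> where p: "is_path K \<one>\<^bsub>F\<^esub> \<gamma> n" "pc \<gamma> = c" "is_path K \<one>\<^bsub>F\<^esub> \<delta> m" "pc \<delta> = d"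
    using assms by (auto simp: reach_def)
  have "is_path K n (lpath n \<delta>) (n \<otimes>\<^bsub>F\<^esub> m)"
    using is_path_lpath[OF p(3) vertex_carrier(2)[OF p(1)]] vertex_carrier(2)[OF p(1)] by simp
  from reachI[OF K.is_path_appendI[OF p(1) this]] show ?thesis by (simp add: pc_lpath p)
qed

lemma reach_inv:
  assumes "reach n c"
  shows "reach (inv\<^bsub>F\<^esub> n) (- c)"
proof -
  obtain \<gamma> where p: "is_path K \<one>\<^bsub>F\<^esub> \<gamma> n" "pc \<gamma> = c" using assms by (auto simp: reach_def)
  note n = vertex_carrier(2)[OF p(1)]
  have "is_path K \<one>\<^bsub>F\<^esub> (lpath (inv\<^bsub>F\<^esub> n) (inv_path \<gamma>)) (inv\<^bsub>F\<^esub> n)"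
    using is_path_lpath[OF K.is_path_inv[OF p(1)], of "inv\<^bsub>F\<^esub> n"] n by simp
  from reachI[OF this] show ?thesis by (simp add: pc_lpath pc_inv_path p)
qed

text \<open>The end points form a normal subgroup containing all relators, hence contain the normal
  closure.\<close>

lemma ex_path_in_N:
  assumes "n \<in> N"
  shows "\<exists>\<gamma>. is_path K \<one>\<^bsub>F\<^esub> \<gamma> n"
proof -
  \<comment> \<open>The contribution is left unspecified because the right translation used for
    conjugates changes it.\<close>
  let ?E = "{n. \<exists>c. reach n c}"
  have "?E \<lhd> F"
  proof (rule F.normal_invI)
    show "subgroup ?E F"
    proof (rule F.subgroupI)
      show "?E \<subseteq> carrier F" using reach_phi(1) N.mem_carrier by blast
      show "?E \<noteq> {}" using reach_one by blast
    qed (use reach_mult reach_inv in blast)+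
    fix x h assume x: "x \<in> carrier F" and "h \<in> ?E"
    then obtain \<gamma> where \<gamma>: "is_path K \<one>\<^bsub>F\<^esub> \<gamma> h" by (auto simp: reach_def)
    have "is_path K \<one>\<^bsub>F\<^esub> (rpath (lpath x \<gamma>) (inv\<^bsub>F\<^esub> x)) (x \<otimes>\<^bsub>F\<^esub> h \<otimes>\<^bsub>F\<^esub> inv\<^bsub>F\<^esub> x)"
      using is_path_rpath[OF is_path_lpath[OF \<gamma> x], of "inv\<^bsub>F\<^esub> x"] x by simp
    then show "x \<otimes>\<^bsub>F\<^esub> h \<otimes>\<^bsub>F\<^esub> inv\<^bsub>F\<^esub> x \<in> ?E" by (auto simp: reach_def)
  qed
  moreover have "relator s \<in> ?E" if s: "s \<in> R" for s
  proof -
    obtain l r where lr: "s = (l, r)" "(l, r) \<in> R" using s by (cases s) auto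
    \<comment> \<open>A single edge with p = l^-1 and q = 1 starts at 1 and ends at l^-1 r.\<close>
    have "is_path K \<one>\<^bsub>F\<^esub> [((inv\<^bsub>F\<^esub> rho l, l, r, \<one>\<^bsub>F\<^esub>), True)] (relator s)"
      using lr rho_closed[OF lr(2)] by (simp add: K_simps dsrc_def dtgt_def relator_eq)
    from reachI[OF this] show ?thesis by blast
  qed
  ultimately have "N \<subseteq> ?E" by (intro relator_subgroup_minimal) auto
  with assms show ?thesis by (auto simp: reach_def)
qed

lemma ex_reach_contribution:
  assumes "Poly_Mapping.keys c \<subseteq> R \<times> carrier G"
  shows "\<exists>n. reach n c"
  using assms
proof (rule free_Abelian_group_induct)
  show "\<exists>n. reach n 0" using reach_one by blast
next
  fix x y assume "\<exists>n. reach n x" "\<exists>n. reach n y"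
  then show "\<exists>n. reach n (x - y)" using reach_mult reach_inv by (metis diff_conv_add_uminus)
next
  fix a assume "a \<in> R \<times> carrier G"
  then obtain l r q where a: "a = ((l, r), \<theta> q)" "(l, r) \<in> R" "q \<in> carrier F"
    by (auto simp: carrier_G)
  \<comment> \<open>The contribution fixes \<open>q\<close> only up to \<theta> and leaves
    \<open>p\<close> free; this \<open>p\<close> solves p l q = 1, so that the edge starts at
    1.\<close>
  let ?p = "inv\<^bsub>F\<^esub> (rho l \<otimes>\<^bsub>F\<^esub> q)"
  have "is_path K \<one>\<^bsub>F\<^esub> [((?p, l, r, q), True)] (?p \<otimes>\<^bsub>F\<^esub> rho r \<otimes>\<^bsub>F\<^esub> q)"
    using a rho_closed[OF a(2)] by (simp add: K_simps dsrc_def dtgt_def F.m_assoc)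
  from reachI[OF this] show "\<exists>n. reach n (frag_of a)" by (auto simp: a)
qed

text \<open>Whatever c and d are contributed by paths to a and b, the commutator pattern yields c +
  d - c - d, which vanishes since the free module is Abelian.\<close>

lemma reach_derived:
  assumes "n \<in> D"
  shows "reach n 0"
proof -
  have comm: "reach h 0" if h: "h \<in> derived_set F N" for h
  proof -
    obtain a b where ab: "a \<in> N" "b \<in> N" "h = a \<otimes>\<^bsub>F\<^esub> b \<otimes>\<^bsub>F\<^esub> inv\<^bsub>F\<^esub> a \<otimes>\<^bsub>F\<^esub> inv\<^bsub>F\<^esub> b"
      using h by blast
    obtain \<gamma> \<delta> where "is_path K \<one>\<^bsub>F\<^esub> \<gamma> a" "is_path K \<one>\<^bsub>F\<^esub> \<delta> b"
      using ex_path_in_N[OF ab(1)] ex_path_in_N[OF ab(2)] by blast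
    then obtain c d where "reach a c" "reach b d" using reachI by metis
    then have "reach h (c + d + - c + - d)"
      unfolding ab(3) by (intro reach_mult reach_inv)
    then show ?thesis by simp
  qed
  show ?thesis
    using assms unfolding derived_def
  proof induction
    case one
    show ?case by (rule reach_one)
  next
    case (incl h)
    then show ?case by (rule comm)
  next
    case (inv h)
    then show ?case using reach_inv[OF comm[OF inv]] by simp
  next
    case (eng a b)
    then show ?case using reach_mult[of a 0 b 0] by simp
  qed
qed

lemma phi_surj:
  assumes "a \<in> carrier RM"
  shows "\<exists>c. Poly_Mapping.keys c \<subseteq> R \<times> carrier G \<and> \<phi> c = a"
proof -
  obtain n where n: "n \<in> N" "a = cls n" using assms by (auto simp: RM_simps)
  then obtain \<gamma> where "is_path K \<one>\<^bsub>F\<^esub> \<gamma> n" using ex_path_in_N by blast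
  from reach_phi[OF reachI[OF this]] n show ?thesis by auto
qed

lemma phi_eq_one_iff:
  assumes "Poly_Mapping.keys c \<subseteq> R \<times> carrier G"
  shows "\<phi> c = \<one>\<^bsub>RM\<^esub> \<longleftrightarrow> (\<exists>\<gamma>. is_path K \<one>\<^bsub>F\<^esub> \<gamma> \<one>\<^bsub>F\<^esub> \<and> pc \<gamma> = c)"
proof
  assume phi: "\<phi> c = \<one>\<^bsub>RM\<^esub>"
  obtain n where n: "reach n c" using ex_reach_contribution[OF assms] by blast
  have "n \<in> D" using reach_phi(3)[OF n] phi cls_eq_one_iff[OF reach_phi(1)[OF n]] by simp
  then have "reach (n \<otimes>\<^bsub>F\<^esub> inv\<^bsub>F\<^esub> n) (c + - 0)" using n by (intro reach_mult reach_inv reach_derived)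
  then show "\<exists>\<gamma>. is_path K \<one>\<^bsub>F\<^esub> \<gamma> \<one>\<^bsub>F\<^esub> \<and> pc \<gamma> = c"
    using reach_phi(1)[OF n] N.mem_carrier by (simp add: reach_def)
next
  assume "\<exists>\<gamma>. is_path K \<one>\<^bsub>F\<^esub> \<gamma> \<one>\<^bsub>F\<^esub> \<and> pc \<gamma> = c"
  then have "reach \<one>\<^bsub>F\<^esub> c" by (simp add: reach_def)
  from reach_phi(3)[OF this] show "\<phi> c = \<one>\<^bsub>RM\<^esub>" by (simp add: RM_one)
qed

section \<open>The fundamental group as a module\<close>

abbreviation "PM \<equiv> pi1_module X R"
abbreviation "loop_class \<equiv> homotopy_class K \<one>\<^bsub>F\<^esub> \<one>\<^bsub>F\<^esub>"
abbreviation "loop \<gamma> \<equiv> is_path K \<one>\<^bsub>F\<^esub> \<gamma> \<one>\<^bsub>F\<^esub>"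

lemma carrier_PM: "carrier PM = loop_class ` {\<gamma>. loop \<gamma>}"
  by (simp add: pi1_module_def pi1_squier_def fundamental_group_def)

lemma PM_mult: "loop \<gamma> \<Longrightarrow> loop \<delta> \<Longrightarrow> loop_class \<gamma> \<otimes>\<^bsub>PM\<^esub> loop_class \<delta> = loop_class (\<gamma> @ \<delta>)"
  using K.fundamental_group_mult by (simp add: pi1_module_def pi1_squier_def)

lemma pi1_to_free_class: "loop \<gamma> \<Longrightarrow> pi1_to_free X R (loop_class \<gamma>) = pc \<gamma>"
  unfolding pi1_to_free_def by (rule K.on_homotopy_class) (auto dest: pc_homotopic)

lemma pi1_conj_class:
  assumes "loop \<gamma>" "q \<in> carrier F"
  shows "pi1_conj X R (loop_class \<gamma>) q = loop_class (rpath (lpath (inv\<^bsub>F\<^esub> q) \<gamma>) q)"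
  unfolding pi1_conj_def Let_def
  by (rule K.on_homotopy_class[OF assms(1)])
    (rule K.homotopy_class_eq[OF homotopic.sym[OF homotopic_conj[OF _ assms(2)]]])

text \<open>Another representative of \<theta> q has the form n q with n in \<open>N\<close>. Some
  path joins 1 to n, so conjugation by n fixes every loop class and only the conjugation by q
  remains.\<close>

lemma ract_PM:
  assumes "loop \<gamma>" "q \<in> carrier F"
  shows "ract PM (loop_class \<gamma>) (\<theta> q) = loop_class (rpath (lpath (inv\<^bsub>F\<^esub> q) \<gamma>) q)"
proof -
  have "on_class (pi1_conj X R (loop_class \<gamma>)) (\<theta> q) = pi1_conj X R (loop_class \<gamma>) q"
  proof (rule on_class_eq)
    show "q \<in> \<theta> q" unfolding theta_def by (rule F.rcos_self[OF assms(2) N.subgroup_axioms])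
    fix q' assume "q' \<in> \<theta> q"
    then obtain n where n: "n \<in> N" "q' = n \<otimes>\<^bsub>F\<^esub> q" using in_theta_iff[of q q'] assms(2) by auto
    have nF: "n \<in> carrier F" using n N.mem_carrier by blast
    obtain \<delta> where "is_path K \<one>\<^bsub>F\<^esub> \<delta> n" using ex_path_in_N n by blast
    from K.homotopy_class_eq[OF homotopic_conj_connected[OF assms(1) this]]
    have "pi1_conj X R (loop_class \<gamma>) q = pi1_conj X R (loop_class (rpath (lpath (inv\<^bsub>F\<^esub> n) \<gamma>) n)) q"
      by simp
    also have "\<dots> = loop_class (rpath (lpath (inv\<^bsub>F\<^esub> q) (rpath (lpath (inv\<^bsub>F\<^esub> n) \<gamma>) n)) q)"
      using conj_path[OF assms(1) nF] assms(2) by (rule pi1_conj_class)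
    also have "lpath (inv\<^bsub>F\<^esub> q) (rpath (lpath (inv\<^bsub>F\<^esub> n) \<gamma>) n)
        = rpath (lpath (inv\<^bsub>F\<^esub> q) (lpath (inv\<^bsub>F\<^esub> n) \<gamma>)) n"
      using is_path_lpath[OF assms(1), of "inv\<^bsub>F\<^esub> n"] assms(2) nF by (intro act_comp(5)) simp_all
    also have "lpath (inv\<^bsub>F\<^esub> q) (lpath (inv\<^bsub>F\<^esub> n) \<gamma>) = lpath (inv\<^bsub>F\<^esub> q') \<gamma>"
      using act_comp(1)[OF assms(1), of "inv\<^bsub>F\<^esub> q" "inv\<^bsub>F\<^esub> n"] assms(2) nF n by (simp add: F.inv_mult_group)
    also have "rpath (rpath (lpath (inv\<^bsub>F\<^esub> q') \<gamma>) n) q = rpath (lpath (inv\<^bsub>F\<^esub> q') \<gamma>) q'"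
      unfolding n(2) using is_path_lpath[OF assms(1), of "inv\<^bsub>F\<^esub> (n \<otimes>\<^bsub>F\<^esub> q)"] assms(2) nF
      by (intro act_comp(2)) simp_all
    also have "loop_class \<dots> = pi1_conj X R (loop_class \<gamma>) q'"
      using pi1_conj_class[OF assms(1), of q'] nF n assms(2) by simp
    finally show "pi1_conj X R (loop_class \<gamma>) q' = pi1_conj X R (loop_class \<gamma>) q" by simp
  qed
  then show ?thesis using pi1_conj_class[OF assms] by (simp add: pi1_module_def)
qed

text \<open>In the conjugated loop the left translation by q^-1 does not affect the contribution,
  and the right translation by q acts on it as \<theta> q.\<close>

lemma pi1_to_free_ract:
  assumes "\<alpha> \<in> carrier PM" "g \<in> carrier G"
  shows "ract PM \<alpha> g \<in> carrier PM" "pi1_to_free X R (ract PM \<alpha> g) = ract FM (pi1_to_free X R \<alpha>) g"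
proof -
  obtain \<gamma> q where *: "loop \<gamma>" "\<alpha> = loop_class \<gamma>" "q \<in> carrier F" "g = \<theta> q"
    using assms by (auto simp: carrier_PM carrier_G)
  note c = conj_path[OF *(1,3)]
  show "ract PM \<alpha> g \<in> carrier PM" using * c by (auto simp: ract_PM carrier_PM)
  have "pc (rpath (lpath (inv\<^bsub>F\<^esub> q) \<gamma>) q) = ract FM (pc (lpath (inv\<^bsub>F\<^esub> q) \<gamma>)) (\<theta> q)"
    using is_path_lpath[OF *(1), of "inv\<^bsub>F\<^esub> q"] * by (intro pc_rpath) simp_all
  then show "pi1_to_free X R (ract PM \<alpha> g) = ract FM (pi1_to_free X R \<alpha>) g"
    using * c by (simp add: ract_PM pi1_to_free_class pc_lpath)
qed

end

section \<open>The Cockcroft property\<close>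

locale presentation_subgroup = presentation X R
    for X :: "'x set" and R :: "'x relation set" +
  fixes L :: "'x word set set"
  assumes subgroup_L: "subgroup L G"
begin

abbreviation "cosets \<equiv> lcosets\<^bsub>G\<^esub> L"
abbreviation "B \<equiv> free_Abelian_group (R \<times> cosets)"

lemma L_carrier: "g \<in> L \<Longrightarrow> g \<in> carrier G"
  by (rule subgroup.mem_carrier[OF subgroup_L])

lemma lcoset_in_cosets: "g \<in> carrier G \<Longrightarrow> g <#\<^bsub>G\<^esub> L \<in> cosets"
  by (auto simp: LCOSETS_def)

lemma lcoset_mult_L:
  assumes "g \<in> carrier G" "h \<in> L"
  shows "(g \<otimes>\<^bsub>G\<^esub> h) <#\<^bsub>G\<^esub> L = g <#\<^bsub>G\<^esub> L"
proof -
  have "g \<otimes>\<^bsub>G\<^esub> h \<in> g <#\<^bsub>G\<^esub> L" using assms by (auto simp: l_coset_def)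
  then show ?thesis using G.l_repr_independence[OF _ assms(1) subgroup_L] by simp
qed

sublocale PM: closed_right_module L PM
proof
  fix m m' assume "m \<in> carrier PM" "m' \<in> carrier PM"
  then obtain \<gamma> \<delta> where "loop \<gamma>" "loop \<delta>" "m = loop_class \<gamma>" "m' = loop_class \<delta>"
    by (auto simp: carrier_PM)
  then show "m \<otimes>\<^bsub>PM\<^esub> m' \<in> carrier PM"
    using K.is_path_appendI[of "\<one>\<^bsub>F\<^esub>" \<gamma> "\<one>\<^bsub>F\<^esub>" \<delta> "\<one>\<^bsub>F\<^esub>"] by (simp add: PM_mult carrier_PM)
qed (intro pi1_to_free_ract(1) L_carrier)

sublocale FM: closed_right_module L FM
proof
  fix m m' assume "m \<in> carrier FM" "m' \<in> carrier FM"
  then show "m \<otimes>\<^bsub>FM\<^esub> m' \<in> carrier FM" using keys_add[of m m'] by auto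
next
  fix m g assume "m \<in> carrier FM" "g \<in> L"
  then show "ract FM m g \<in> carrier FM" using keys_ract_FM[of m g] L_carrier by simp
qed

sublocale RM: closed_right_module L RM
  by unfold_locales (auto intro: ract_RM_closed L_carrier)

section \<open>Projection to cosets and evaluation of tensors\<close>

definition proj :: "('x relation \<times> 'x word set \<Rightarrow>\<^sub>0 int) \<Rightarrow> ('x relation \<times> 'x word set set \<Rightarrow>\<^sub>0 int)" where
  "proj = frag_extend (\<lambda>(s, g). frag_of (s, g <#\<^bsub>G\<^esub> L))"

lemma proj_simps [simp]:
  "proj 0 = 0" "proj (c + d) = proj c + proj d" "proj (c - d) = proj c - proj d" "proj (- c) = - proj c"
  "proj (frag_of (s, g)) = frag_of (s, g <#\<^bsub>G\<^esub> L)"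
  by (simp_all add: proj_def frag_extend_add frag_extend_diff frag_extend_minus)

lemma proj_hom: "proj \<in> hom A B"
  unfolding proj_def by (intro frag_extend_hom) (auto simp: lcoset_in_cosets)

lemma proj_ract:
  assumes "Poly_Mapping.keys c \<subseteq> R \<times> carrier G" "g \<in> L"
  shows "proj (ract FM c g) = proj c"
  using assms(1)
  by (rule free_Abelian_group_induct)
    (auto simp: frag_extend_diff lcoset_mult_L assms(2))

text \<open>The map on formal sums of pairs that induces \<open>coset_identification\<close> on
  classes.\<close>

definition coset_value ::
  "(('x relation \<times> 'x word set \<Rightarrow>\<^sub>0 int) \<times> int \<Rightarrow>\<^sub>0 int) \<Rightarrow> ('x relation \<times> 'x word set set \<Rightarrow>\<^sub>0 int)" where
  "coset_value = frag_extend (\<lambda>(c, n). frag_cmul n (proj c))"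

lemma coset_value_simps [simp]:
  "coset_value 0 = 0" "coset_value (x + y) = coset_value x + coset_value y"
  "coset_value (x - y) = coset_value x - coset_value y" "coset_value (- x) = - coset_value x"
  "coset_value (frag_of (c, n)) = frag_cmul n (proj c)"
  by (simp_all add: coset_value_def frag_extend_add frag_extend_diff frag_extend_minus)

lemma keys_coset_value:
  assumes "Poly_Mapping.keys x \<subseteq> carrier FM \<times> UNIV"
  shows "Poly_Mapping.keys (coset_value x) \<subseteq> R \<times> cosets"
proof -
  have "coset_value \<in> hom (free_Abelian_group (carrier FM \<times> UNIV)) B"
    unfolding coset_value_def
  proof (rule frag_extend_hom)
    fix x :: "('x relation \<times> 'x word set \<Rightarrow>\<^sub>0 int) \<times> int" assume "x \<in> carrier FM \<times> UNIV"
    then obtain c n where x: "x = (c, n)" "c \<in> carrier A" by auto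
    have "Poly_Mapping.keys (proj c) \<subseteq> R \<times> cosets" using hom_in_carrier[OF proj_hom x(2)] by simp
    then show "Poly_Mapping.keys (case x of (c, n) \<Rightarrow> frag_cmul n (proj c)) \<subseteq> R \<times> cosets"
      unfolding x(1) prod.case by (rule order_trans[OF keys_cmul])
  qed
  from hom_in_carrier[OF this] show ?thesis using assms by simp
qed

text \<open>The value is additive in both arguments, and right multiplication by elements of
  \<open>L\<close> does not move left cosets.\<close>

lemma coset_value_kernel: "z \<in> tensor_int_kernel L FM \<Longrightarrow> coset_value z = 0"
proof (induction rule: FM.kernel_induct)
  case (base h)
  then show ?case
    unfolding tensor_relations_def
    by (auto simp: frag_cmul_distrib frag_cmul_distrib2 proj_ract simp del: FM_simps(4))
qed simp_all

lemma coset_identification_class: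
  "coset_identification X R L (tensor_int_class L FM x) = coset_value x"
  unfolding coset_identification_def coset_value_def[unfolded proj_def, symmetric]
proof (rule on_class_eq)
  show "x \<in> tensor_int_class L FM x" by (simp only: FM.in_class_iff) (simp add: FM.kernel_0)
  fix y assume "y \<in> tensor_int_class L FM x"
  then have "coset_value (y - x) = 0" by (simp only: FM.in_class_iff coset_value_kernel)
  then show "coset_value y = coset_value x" by simp
qed

lemma pi1_to_free_closed: "\<alpha> \<in> carrier PM \<Longrightarrow> pi1_to_free X R \<alpha> \<in> carrier FM"
  by (auto simp: carrier_PM pi1_to_free_class dest: subsetD[OF keys_pc])

lemma pi1_tensor_map_class:
  "pi1_tensor_map X R L (tensor_int_class L PM x)
    = coset_value (frag_extend (\<lambda>(\<alpha>, n). frag_of (pi1_to_free X R \<alpha>, n)) x)"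
proof -
  have "tensor_map L PM FM trivial_int (pi1_to_free X R) (tensor_int_class L PM x)
    = tensor_int_class L FM (frag_extend (\<lambda>(\<alpha>, n). frag_of (pi1_to_free X R \<alpha>, n)) x)"
  proof (rule tensor_map_class)
    fix \<alpha> \<beta> assume "\<alpha> \<in> carrier PM" "\<beta> \<in> carrier PM"
    then obtain \<gamma> \<delta> where *: "loop \<gamma>" "loop \<delta>" "\<alpha> = loop_class \<gamma>" "\<beta> = loop_class \<delta>"
      by (auto simp: carrier_PM)
    show "pi1_to_free X R (\<alpha> \<otimes>\<^bsub>PM\<^esub> \<beta>) = pi1_to_free X R \<alpha> \<otimes>\<^bsub>FM\<^esub> pi1_to_free X R \<beta>"
      using K.is_path_appendI[OF *(1,2)] * by (simp add: PM_mult pi1_to_free_class)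
  qed (simp_all only: pi1_to_free_closed pi1_to_free_ract(2) L_carrier PM.closed_right_module_axioms
      FM.closed_right_module_axioms)
  then show ?thesis unfolding pi1_tensor_map_def by (simp only: coset_identification_class)
qed

text \<open>By exactness in the middle, the kernel of \<phi> consists of the contributions of loops.
  A generator \<alpha> tensor n goes to n times the projected contribution of \<alpha>, so the
  generators with n = 1 decide.\<close>

lemma pi1_tensor_map_zero_iff:
  "(\<forall>t \<in> carrier (tensor L PM trivial_int). pi1_tensor_map X R L t = 0)
    \<longleftrightarrow> (\<forall>c. Poly_Mapping.keys c \<subseteq> R \<times> carrier G \<longrightarrow> \<phi> c = \<one>\<^bsub>RM\<^esub> \<longrightarrow> proj c = 0)"
    (is "?lhs \<longleftrightarrow> ?rhs")
proof
  assume lhs: ?lhs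
  show ?rhs
  proof (intro allI impI)
    fix c assume c: "Poly_Mapping.keys c \<subseteq> R \<times> carrier G" "\<phi> c = \<one>\<^bsub>RM\<^esub>"
    then obtain \<gamma> where \<gamma>: "loop \<gamma>" "pc \<gamma> = c" using phi_eq_one_iff by blast
    then have "loop_class \<gamma> \<in> carrier PM" by (auto simp: carrier_PM)
    then have "tensor_int_class L PM (frag_of (loop_class \<gamma>, 1)) \<in> carrier (tensor L PM trivial_int)"
      unfolding PM.carrier_tensor by (intro imageI) simp
    with lhs have "pi1_tensor_map X R L (tensor_int_class L PM (frag_of (loop_class \<gamma>, 1))) = 0" by blast
    then show "proj c = 0" unfolding pi1_tensor_map_class using \<gamma> by (simp add: pi1_to_free_class)
  qed
next
  assume rhs: ?rhs
  have zero: "proj (pi1_to_free X R \<alpha>) = 0" if \<alpha>: "\<alpha> \<in> carrier PM" for \<alpha>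
  proof -
    obtain \<gamma> where \<gamma>: "loop \<gamma>" "\<alpha> = loop_class \<gamma>" using \<alpha> by (auto simp: carrier_PM)
    then have "\<phi> (pc \<gamma>) = \<one>\<^bsub>RM\<^esub>" using phi_eq_one_iff[OF keys_pc[OF \<gamma>(1)]] by blast
    then show ?thesis using rhs keys_pc[OF \<gamma>(1)] \<gamma> by (simp add: pi1_to_free_class)
  qed
  show ?lhs
  proof
    fix t assume "t \<in> carrier (tensor L PM trivial_int)"
    then obtain x where x: "t = tensor_int_class L PM x" "Poly_Mapping.keys x \<subseteq> carrier PM \<times> UNIV"
      unfolding PM.carrier_tensor by blast
    show "pi1_tensor_map X R L t = 0"
      unfolding x(1) pi1_tensor_map_class using x(2)
      by (rule free_Abelian_group_induct) (auto simp: frag_extend_diff zero)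
  qed
qed

section \<open>A formula for the map from the coset sum\<close>

definition coset_rep :: "'x word set set \<Rightarrow> 'x word set" where
  "coset_rep C = (SOME g. g \<in> carrier G \<and> C = g <#\<^bsub>G\<^esub> L)"

lemma coset_rep:
  assumes "C \<in> cosets"
  shows "coset_rep C \<in> carrier G" "coset_rep C <#\<^bsub>G\<^esub> L = C"
proof -
  have "\<exists>g. g \<in> carrier G \<and> C = g <#\<^bsub>G\<^esub> L" using assms by (auto simp: LCOSETS_def)
  from someI_ex[OF this] show "coset_rep C \<in> carrier G" "coset_rep C <#\<^bsub>G\<^esub> L = C"
    by (simp_all add: coset_rep_def)
qed

lemma coset_rep_lcoset:
  assumes "g \<in> carrier G"
  obtains h where "h \<in> L" "coset_rep (g <#\<^bsub>G\<^esub> L) = g \<otimes>\<^bsub>G\<^esub> h"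
proof -
  note r = coset_rep[OF lcoset_in_cosets[OF assms]]
  have "coset_rep (g <#\<^bsub>G\<^esub> L) \<in> g <#\<^bsub>G\<^esub> L" using G.lcos_self[OF r(1) subgroup_L] r(2) by simp
  then show thesis using that by (auto simp: l_coset_def)
qed

text \<open>Represents the map in (a) on generators: \<open>(s, gL)\<close> goes to \<phi>(e_s g)
  tensor 1. Another representative of the coset would give the same element modulo the tensor
  relations.\<close>

definition lift_cosets :: "('x relation \<times> 'x word set set \<Rightarrow>\<^sub>0 int) \<Rightarrow> ('x word set \<times> int \<Rightarrow>\<^sub>0 int)" where
  "lift_cosets = frag_extend (\<lambda>(s, C). frag_of (\<phi> (frag_of (s, coset_rep C)), 1))"

lemma lift_cosets_simps [simp]:
  "lift_cosets 0 = 0" "lift_cosets (x + y) = lift_cosets x + lift_cosets y"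
  "lift_cosets (x - y) = lift_cosets x - lift_cosets y" "lift_cosets (- x) = - lift_cosets x"
  "lift_cosets (frag_cmul n x) = frag_cmul n (lift_cosets x)"
  "lift_cosets (frag_of (s, C)) = frag_of (\<phi> (frag_of (s, coset_rep C)), 1)"
  by (simp_all add: lift_cosets_def frag_extend_add frag_extend_diff frag_extend_minus frag_extend_cmul)

lemma keys_lift_cosets:
  assumes "Poly_Mapping.keys d \<subseteq> R \<times> cosets"
  shows "Poly_Mapping.keys (lift_cosets d) \<subseteq> carrier RM \<times> UNIV"
proof -
  have "lift_cosets \<in> hom B (free_Abelian_group (carrier RM \<times> UNIV))"
    unfolding lift_cosets_def by (intro frag_extend_hom) (auto intro!: phi_closed simp: coset_rep)
  from hom_in_carrier[OF this] show ?thesis using assms by simp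
qed

lemma RM_add_relation:
  assumes "a \<in> carrier RM" "b \<in> carrier RM"
  shows "frag_of (a \<otimes>\<^bsub>RM\<^esub> b, n) - frag_of (a, n) - frag_of (b, n) \<in> tensor_int_kernel L RM"
  by (rule RM.kernel_relation) (use assms in \<open>force simp: tensor_relations_def\<close>)

lemma RM_ract_relation:
  assumes "a \<in> carrier RM" "g \<in> L"
  shows "frag_of (ract RM a g, n) - frag_of (a, n) \<in> tensor_int_kernel L RM"
  by (rule RM.kernel_relation) (use assms in \<open>force simp: tensor_relations_def\<close>)

text \<open>The additivity relation for the product of the unit with itself is the negative of this
  element.\<close>

lemma RM_one_relation: "frag_of (\<one>\<^bsub>RM\<^esub>, n) \<in> tensor_int_kernel L RM"
  using RM.kernel_minus[OF RM_add_relation[of "\<one>\<^bsub>RM\<^esub>" "\<one>\<^bsub>RM\<^esub>" n]] by simp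

text \<open>The representative chosen for the coset of g is g h with h in \<open>L\<close>, and
  \<phi>(e_s g h) is \<phi>(e_s g) acted on by h, which the tensor relations identify with
  \<phi>(e_s g).\<close>

lemma lift_cosets_proj:
  assumes "Poly_Mapping.keys c \<subseteq> R \<times> carrier G"
  shows "lift_cosets (proj c) - frag_of (\<phi> c, 1) \<in> tensor_int_kernel L RM"
  using assms
proof (rule free_Abelian_group_induct)
  have "\<phi> 0 = \<one>\<^bsub>RM\<^esub>" using phi.hom_one by (simp only: one_free_Abelian_group)
  then show "lift_cosets (proj 0) - frag_of (\<phi> 0, 1) \<in> tensor_int_kernel L RM"
    using RM.kernel_minus[OF RM_one_relation[of 1]] by simp
next
  fix c d assume k: "Poly_Mapping.keys c \<subseteq> R \<times> carrier G" "Poly_Mapping.keys d \<subseteq> R \<times> carrier G"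
    and IH: "lift_cosets (proj c) - frag_of (\<phi> c, 1) \<in> tensor_int_kernel L RM"
      "lift_cosets (proj d) - frag_of (\<phi> d, 1) \<in> tensor_int_kernel L RM"
  have k': "Poly_Mapping.keys (c - d) \<subseteq> R \<times> carrier G" using k keys_diff[of c d] by blast
  \<comment> \<open>The induction supplies differences but the relation concerns products, so
    \<open>c\<close> is read as the sum of \<open>c - d\<close> and \<open>d\<close>.\<close>
  have "\<phi> c = \<phi> (c - d) \<otimes>\<^bsub>RM\<^esub> \<phi> d" using phi_add[OF k' k(2)] by simp
  then have "frag_of (\<phi> c, 1) - frag_of (\<phi> (c - d), 1) - frag_of (\<phi> d, 1) \<in> tensor_int_kernel L RM"
    using RM_add_relation[OF phi_closed[OF k'] phi_closed[OF k(2)]] by simp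
  from RM.kernel_add[OF RM.kernel_diff[OF IH] this]
  show "lift_cosets (proj (c - d)) - frag_of (\<phi> (c - d), 1) \<in> tensor_int_kernel L RM"
    by (simp add: algebra_simps)
next
  fix a assume "a \<in> R \<times> carrier G"
  then obtain s g where a: "a = (s, g)" "s \<in> R" "g \<in> carrier G" by auto
  obtain h where h: "h \<in> L" "coset_rep (g <#\<^bsub>G\<^esub> L) = g \<otimes>\<^bsub>G\<^esub> h" using coset_rep_lcoset[OF a(3)] .
  have "\<phi> (frag_of (s, g \<otimes>\<^bsub>G\<^esub> h)) = ract RM (\<phi> (frag_of (s, g))) h"
    using phi_ract[of "frag_of (s, g)" h] a h L_carrier by simp
  then show "lift_cosets (proj (frag_of a)) - frag_of (\<phi> (frag_of a), 1) \<in> tensor_int_kernel L RM"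
    using RM_ract_relation[of "\<phi> (frag_of (s, g))" h 1] phi_closed[of "frag_of (s, g)"] a h by simp
qed

text \<open>On a generator c tensor n this combines the case n = 1 with \<phi>(c) tensor n = n
  (\<phi>(c) tensor 1). It says that the image of \<open>x\<close> depends on
  \<open>coset_value x\<close> alone.\<close>

lemma lift_cosets_coset_value:
  assumes "Poly_Mapping.keys x \<subseteq> carrier FM \<times> UNIV"
  shows "lift_cosets (coset_value x) - frag_extend (\<lambda>(c, n). frag_of (\<phi> c, n)) x \<in> tensor_int_kernel L RM"
  using assms
proof (rule free_Abelian_group_induct)
  fix x y
  assume "lift_cosets (coset_value x) - frag_extend (\<lambda>(c, n). frag_of (\<phi> c, n)) x \<in> tensor_int_kernel L RM"
    "lift_cosets (coset_value y) - frag_extend (\<lambda>(c, n). frag_of (\<phi> c, n)) y \<in> tensor_int_kernel L RM"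
  from RM.kernel_diff[OF this]
  show "lift_cosets (coset_value (x - y)) - frag_extend (\<lambda>(c, n). frag_of (\<phi> c, n)) (x - y)
      \<in> tensor_int_kernel L RM"
    by (simp add: frag_extend_diff algebra_simps)
next
  fix a :: "('x relation \<times> 'x word set \<Rightarrow>\<^sub>0 int) \<times> int" assume "a \<in> carrier FM \<times> UNIV"
  then obtain c n where a: "a = (c, n)" "Poly_Mapping.keys c \<subseteq> R \<times> carrier G" by auto
  have "frag_cmul n (lift_cosets (proj c) - frag_of (\<phi> c, 1))
      = frag_cmul n (lift_cosets (proj c)) - frag_cmul n (frag_of (\<phi> c, 1))"
    using frag_cmul_distrib2[of n "lift_cosets (proj c) - frag_of (\<phi> c, 1)" "frag_of (\<phi> c, 1)"] by simp
  with RM.kernel_diff[OF RM.kernel_cmul[OF lift_cosets_proj[OF a(2)], of n]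
      RM.kernel_frag_of_int[OF phi_closed[OF a(2)], of n]]
  show "lift_cosets (coset_value (frag_of a)) - frag_extend (\<lambda>(c, n). frag_of (\<phi> c, n)) (frag_of a)
      \<in> tensor_int_kernel L RM"
    by (simp add: a)
qed (simp add: RM.kernel_0)

lemma tensor_map_phi:
  "tensor_map L FM RM trivial_int \<phi> (tensor_int_class L FM x)
    = tensor_int_class L RM (frag_extend (\<lambda>(c, n). frag_of (\<phi> c, n)) x)"
proof (rule tensor_map_class)
  fix c g assume "c \<in> carrier FM" "g \<in> L"
  then show "\<phi> (ract FM c g) = ract RM (\<phi> c) g" by (intro phi_ract) (simp_all add: L_carrier)
qed (simp_all add: phi_closed phi_add FM.closed_right_module_axioms RM.closed_right_module_axioms)

text \<open>Ensures that the \<open>inv_into\<close> in \<open>Nab_tensor_map\<close> returns a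
  genuine preimage.\<close>

lemma coset_identification_surj:
  assumes "Poly_Mapping.keys d \<subseteq> R \<times> cosets"
  shows "d \<in> coset_identification X R L ` carrier (tensor L FM trivial_int)"
proof -
  let ?c = "frag_extend (\<lambda>(s, C). frag_of (s, coset_rep C)) d"
  have "frag_extend (\<lambda>(s, C). frag_of (s, coset_rep C)) \<in> hom B A"
    by (intro frag_extend_hom) (auto simp: coset_rep)
  from hom_in_carrier[OF this] have c: "Poly_Mapping.keys ?c \<subseteq> R \<times> carrier G" using assms by simp
  have "proj ?c = d"
    using assms by (rule free_Abelian_group_induct) (auto simp: frag_extend_diff coset_rep)
  then have "coset_identification X R L (tensor_int_class L FM (frag_of (?c, 1))) = d"
    unfolding coset_identification_class by simp
  moreover have "tensor_int_class L FM (frag_of (?c, 1)) \<in> carrier (tensor L FM trivial_int)"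
    unfolding FM.carrier_tensor using c by (intro imageI) simp
  ultimately show ?thesis by force
qed

text \<open>All that is known of the chosen preimage is that its coset value is \<open>d\<close>,
  and this already determines its image in the tensor product.\<close>

lemma Nab_tensor_map_eq:
  assumes "Poly_Mapping.keys d \<subseteq> R \<times> cosets"
  shows "Nab_tensor_map X R L d = tensor_int_class L RM (lift_cosets d)"
proof -
  let ?t = "inv_into (carrier (tensor L FM trivial_int)) (coset_identification X R L) d"
  have "?t \<in> carrier (tensor L FM trivial_int)"
    using coset_identification_surj[OF assms] by (rule inv_into_into)
  then obtain x where x: "?t = tensor_int_class L FM x" "Poly_Mapping.keys x \<subseteq> carrier FM \<times> UNIV"
    unfolding FM.carrier_tensor by blast
  have "coset_identification X R L ?t = d"
    using coset_identification_surj[OF assms] by (rule f_inv_into_f)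
  then have "coset_value x = d" unfolding x(1) coset_identification_class .
  then have "lift_cosets d - frag_extend (\<lambda>(c, n). frag_of (\<phi> c, n)) x \<in> tensor_int_kernel L RM"
    using lift_cosets_coset_value[OF x(2)] by simp
  then show ?thesis unfolding Nab_tensor_map_def x(1) tensor_map_phi RM.class_eq_iff
    using RM.kernel_minus by fastforce
qed

section \<open>Bijectivity of the map from the coset sum\<close>

lemma Nab_tensor_map_hom:
  "Nab_tensor_map X R L \<in> hom (coset_sum X R L) (tensor L RM trivial_int)"
proof (rule homI)
  fix d assume "d \<in> carrier (coset_sum X R L)"
  then have d: "Poly_Mapping.keys d \<subseteq> R \<times> cosets" by (simp add: coset_sum_def)
  show "Nab_tensor_map X R L d \<in> carrier (tensor L RM trivial_int)"
    unfolding Nab_tensor_map_eq[OF d] RM.carrier_tensor using keys_lift_cosets[OF d] by (intro imageI) simp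
next
  fix d e assume "d \<in> carrier (coset_sum X R L)" "e \<in> carrier (coset_sum X R L)"
  then have de: "Poly_Mapping.keys d \<subseteq> R \<times> cosets" "Poly_Mapping.keys e \<subseteq> R \<times> cosets"
    by (simp_all add: coset_sum_def)
  then have "Poly_Mapping.keys (d + e) \<subseteq> R \<times> cosets" using keys_add[of d e] by blast
  then show "Nab_tensor_map X R L (d \<otimes>\<^bsub>coset_sum X R L\<^esub> e)
      = Nab_tensor_map X R L d \<otimes>\<^bsub>tensor L RM trivial_int\<^esub> Nab_tensor_map X R L e"
    using de by (simp only: coset_sum_def mult_free_Abelian_group Nab_tensor_map_eq RM.mult_tensor
        lift_cosets_simps)
qed

text \<open>A section of \<phi> as a map of sets, not assumed additive. Additivity and invariance
  under \<open>L\<close> appear only after \<open>proj\<close>, once \<open>proj\<close> is known to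
  kill the kernel of \<phi>.\<close>

definition phi_lift :: "'x word set \<Rightarrow> ('x relation \<times> 'x word set \<Rightarrow>\<^sub>0 int)" where
  "phi_lift a = (SOME c. Poly_Mapping.keys c \<subseteq> R \<times> carrier G \<and> \<phi> c = a)"

lemma phi_lift:
  assumes "a \<in> carrier RM"
  shows "Poly_Mapping.keys (phi_lift a) \<subseteq> R \<times> carrier G" "\<phi> (phi_lift a) = a"
  using someI_ex[OF phi_surj[OF assms]] by (simp_all add: phi_lift_def)

text \<open>Lifting each a in a sum of tensors a tensor n through \<phi> gives a preimage in the
  tensor product of the free module; its coset value is the required element.\<close>

lemma Nab_tensor_map_surj:
  assumes "t \<in> carrier (tensor L RM trivial_int)"
  shows "t \<in> Nab_tensor_map X R L ` carrier (coset_sum X R L)"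
proof -
  obtain y where y: "t = tensor_int_class L RM y" "Poly_Mapping.keys y \<subseteq> carrier RM \<times> UNIV"
    using assms unfolding RM.carrier_tensor by blast
  let ?l = "frag_extend (\<lambda>(a, n :: int). frag_of (phi_lift a, n))"
  have "?l \<in> hom (free_Abelian_group (carrier RM \<times> UNIV)) (free_Abelian_group (carrier FM \<times> UNIV))"
    using phi_lift(1) by (intro frag_extend_hom) auto
  from hom_in_carrier[OF this] have x: "Poly_Mapping.keys (?l y) \<subseteq> carrier FM \<times> UNIV" using y(2) by simp
  note d = keys_coset_value[OF x]
  have "frag_extend (\<lambda>(c, n). frag_of (\<phi> c, n)) (?l y) = y"
    using y(2) by (rule free_Abelian_group_induct) (auto simp: frag_extend_diff phi_lift(2))
  then have "Nab_tensor_map X R L (coset_value (?l y)) = t"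
    unfolding Nab_tensor_map_eq[OF d] y(1) RM.class_eq_iff using lift_cosets_coset_value[OF x] by simp
  then show ?thesis using d by (force simp: coset_sum_def)
qed

lemma Nab_tensor_map_inj_iff:
  "inj_on (Nab_tensor_map X R L) (carrier (coset_sum X R L))
    \<longleftrightarrow> (\<forall>c. Poly_Mapping.keys c \<subseteq> R \<times> carrier G \<longrightarrow> \<phi> c = \<one>\<^bsub>RM\<^esub> \<longrightarrow> proj c = 0)"
    (is "?inj \<longleftrightarrow> ?rhs")
proof
  assume inj: ?inj
  show ?rhs
  proof (intro allI impI)
    fix c assume c: "Poly_Mapping.keys c \<subseteq> R \<times> carrier G" "\<phi> c = \<one>\<^bsub>RM\<^esub>"
    have p: "Poly_Mapping.keys (proj c) \<subseteq> R \<times> cosets" using hom_in_carrier[OF proj_hom, of c] c by simp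
    \<comment> \<open>The lift represents \<phi>(c) tensor 1, and \<phi>(c) is the neutral element
      of \<open>N^ab\<close>, so this tensor vanishes.\<close>
    have "lift_cosets (proj c) \<in> tensor_int_kernel L RM"
      using RM.kernel_add[OF lift_cosets_proj[OF c(1)] RM_one_relation[of 1]] c(2) by simp
    then have "Nab_tensor_map X R L (proj c) = Nab_tensor_map X R L 0"
      using p by (subst (1 2) Nab_tensor_map_eq) (simp_all only: RM.class_eq_iff, simp_all)
    with inj p show "proj c = 0" by (auto simp: inj_on_def coset_sum_def)
  qed
next
  assume rhs: ?rhs
  \<comment> \<open>Thus \<open>proj\<close> factors through \<phi>, and the choices made in
    \<open>phi_lift\<close> no longer matter.\<close>
  have eq: "proj c = proj d" if "Poly_Mapping.keys c \<subseteq> R \<times> carrier G"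
    "Poly_Mapping.keys d \<subseteq> R \<times> carrier G" "\<phi> c = \<phi> d" for c d
  proof -
    have "Poly_Mapping.keys (c + - d) \<subseteq> R \<times> carrier G" using that keys_add[of c "- d"] by auto
    moreover have "\<phi> (c + - d) = \<one>\<^bsub>RM\<^esub>"
      using that by (subst phi_add) (simp_all add: phi_minus phi_closed)
    ultimately have "proj (c + - d) = 0" using rhs by blast
    then show ?thesis by simp
  qed
  let ?p = "\<lambda>a. proj (phi_lift a)"
  let ?\<Psi> = "frag_extend (\<lambda>(a, n). frag_cmul n (?p a))"
  have p_mult: "?p (a \<otimes>\<^bsub>RM\<^esub> b) = ?p a + ?p b" if "a \<in> carrier RM" "b \<in> carrier RM" for a b
  proof -
    have "Poly_Mapping.keys (phi_lift a + phi_lift b) \<subseteq> R \<times> carrier G"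
      using that phi_lift(1) keys_add[of "phi_lift a" "phi_lift b"] by blast
    then have "?p (a \<otimes>\<^bsub>RM\<^esub> b) = proj (phi_lift a + phi_lift b)"
      using that by (intro eq) (simp_all add: phi_lift phi_add)
    then show ?thesis by simp
  qed
  have p_ract: "?p (ract RM a g) = ?p a" if "a \<in> carrier RM" "g \<in> L" for a g
  proof -
    note g = L_carrier[OF that(2)]
    have "?p (ract RM a g) = proj (ract FM (phi_lift a) g)"
      using that g by (intro eq keys_ract_FM)
        (simp_all add: phi_lift phi_ract ract_RM_closed del: FM_simps)
    then show ?thesis using proj_ract[OF phi_lift(1)] that by simp
  qed
  have ker: "?\<Psi> z = 0" if "z \<in> tensor_int_kernel L RM" for z
    using that
  proof (induction rule: RM.kernel_induct)
    case (base h)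
    then show ?case
      unfolding tensor_relations_def
      by (auto simp: frag_extend_diff frag_cmul_distrib frag_cmul_distrib2 p_mult p_ract)
  qed (simp_all add: frag_extend_minus frag_extend_add)
  have inv: "?\<Psi> (lift_cosets d) = d" if "Poly_Mapping.keys d \<subseteq> R \<times> cosets" for d
    using that
  proof (rule free_Abelian_group_induct)
    fix a assume "a \<in> R \<times> cosets"
    then obtain s C where a: "a = (s, C)" "s \<in> R" "C \<in> cosets" by auto
    let ?e = "frag_of (s, coset_rep C)"
    have k: "Poly_Mapping.keys ?e \<subseteq> R \<times> carrier G" using a coset_rep by simp
    \<comment> \<open>The chosen lift of \<phi>(e) may differ from e, but both have the same image
      under \<phi> and hence the same projection.\<close>
    have "?p (\<phi> ?e) = proj ?e"
      using phi_lift[OF phi_closed[OF k]] k by (intro eq)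
    then show "?\<Psi> (lift_cosets (frag_of a)) = frag_of a" using a coset_rep by simp
  qed (simp_all add: frag_extend_diff)
  show ?inj
  proof (rule inj_onI)
    fix d e assume "d \<in> carrier (coset_sum X R L)" "e \<in> carrier (coset_sum X R L)"
      and eq: "Nab_tensor_map X R L d = Nab_tensor_map X R L e"
    then have de: "Poly_Mapping.keys d \<subseteq> R \<times> cosets" "Poly_Mapping.keys e \<subseteq> R \<times> cosets"
      by (simp_all add: coset_sum_def)
    have "lift_cosets d - lift_cosets e \<in> tensor_int_kernel L RM"
      using eq unfolding Nab_tensor_map_eq[OF de(1)] Nab_tensor_map_eq[OF de(2)] RM.class_eq_iff .
    from ker[OF this] show "d = e" by (simp add: frag_extend_diff inv de)
  qed
qed

lemma Cockcroft_iff: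
  "Cockcroft X R L \<longleftrightarrow> (\<forall>t \<in> carrier (tensor L PM trivial_int). pi1_tensor_map X R L t = 0)"
proof -
  have "Nab_tensor_map X R L ` carrier (coset_sum X R L) = carrier (tensor L RM trivial_int)"
    using Nab_tensor_map_surj hom_in_carrier[OF Nab_tensor_map_hom] by blast
  then show ?thesis
    unfolding Cockcroft_def iso_def pi1_tensor_map_zero_iff Nab_tensor_map_inj_iff[symmetric]
    using Nab_tensor_map_hom by (simp add: bij_betw_def)
qed

end

theorem corollary3p11:
  fixes X :: "'x set" and R :: "'x relation set" and L :: "'x word set set"
  assumes "group_presentation X R"
    and "subgroup L (presented_group X R)"
  shows "Cockcroft X R L \<longleftrightarrow>
    (\<forall>t \<in> carrier (tensor L (pi1_module X R) trivial_int).
      pi1_tensor_map X R L t = \<one>\<^bsub>coset_sum X R L\<^esub>)"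
proof -
  interpret presentation_subgroup X R L
    using assms by (simp add: presentation_subgroup_def presentation_def presentation_subgroup_axioms_def)
  show ?thesis using Cockcroft_iff by (simp add: coset_sum_def)
qed

end
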